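(* Let $K$ be an infinite field, $P=K[x_1,\dots,x_n]$, let $t=x_1^{a_1}\cdots x_n^{a_n}$ be a power product, and let $I=\mathrm{Stable}(t)$. For $j=1,\dots,n$ let $b_j=\sum_{k<j}a_k$ and $c_j=\sum_{k\ge j}a_k$. (a) For every term ordering $\tau$ (and every infinite base field $K$), $\mathrm{gin}_\tau(I)=\sum_{j=1}^n x_1^{b_j}(x_1,\dots,x_j)^{c_j}$. (b) For every distraction matrix $\mathcal{L}$ with entries in $P_1$, $\mathrm{gin}_{\mathrm{drl}}(D_{\mathcal{L}}(I))=\mathrm{gin}_{\mathrm{drl}}(I)$.
   Context: $P$ is standard graded with degree-$d$ components $P_d$. All term orderings are assumed degree-compatible with $x_1>x_2>\dots>x_n$; $\mathrm{drl}$ denotes DegRevLex. For a power product $t\ne 1$, $\mathrm{m}(t)$ is the largest $r$ with $x_r\mid t$. A monomial ideal $I$ is stable if for every power product $t\in I$, $t\neq 1$, and every $i\le \mathrm{m}(t)$ one has $x_i\,t/x_{\mathrm{m}(t)}\in I$. $\mathrm{Stable}(t)$ is the smallest stable ideal containing $t$. A distraction matrix is an infinite matrix $\mathcal{L}=(L_{ij}\mid i=1,\dots,n,\ j\ge 1)$ with $L_{ij}\in P_1$ such that (i) $\langle L_{1j_1},\dots,L_{nj_n}\rangle=P_1$ ($K$-linear span) for all $j_1,\dots,j_n\ge 1$; (ii) there is $N$ with $L_{ij}=L_{iN}$ for all $i$ and all $j>N$. For $t=x_1^{\alpha_1}\cdots x_n^{\alpha_n}$ put $D_{\mathcal{L}}(t)=\prod_{i=1}^n\prod_{j=1}^{\alpha_i}L_{ij}$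 and extend $D_{\mathcal{L}}$ to $P$ by $K$-linearity; $D_{\mathcal{L}}(V)$ is the image of a subspace $V$. For a monomial ideal $I$, $D_{\mathcal{L}}(I)$ is a homogeneous ideal. A matrix $g=(g_{ij})\in GL(n,K)$ acts on $P$ by $K$-algebra automorphisms via $g(x_j)=\sum_i g_{ij}x_i$. For a homogeneous ideal $J$, $\mathrm{gin}_\tau(J)$ is the monomial ideal equal to the initial ideal $\mathrm{in}_\tau(g(J))$ for all $g$ in a suitable nonempty Zariski-open subset of $GL(n,K)$ (well defined by a known theorem of Galligo and Bayer–Stillman). *)

theory Defs
  imports "HOL-Analysis.Analysis" "HOL-Library.Poly_Mapping" "HOL-Library.Set_Algebras"
begin

text \<open>
  The variables \<open>x\<^sub>1, \<dots>, x\<^sub>n\<close> are indexed by a finite linearly ordered type \<open>'n\<close> with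
  \<open>n = CARD('n)\<close> elements, so \<open>x\<^sub>1\<close> belongs to the least and \<open>x\<^sub>n\<close> to the greatest index.
  A power product is identified with its exponent vector, hence multiplication of power products
  is addition, and the power product 1 is \<open>0\<close>.
\<close>

type_synonym 'n pp = "'n \<Rightarrow>\<^sub>0 nat"
type_synonym ('n, 'a) mpoly = "'n pp \<Rightarrow>\<^sub>0 'a"

definition const :: "'a \<Rightarrow> ('n, 'a::zero) mpoly"
  where "const c = Poly_Mapping.single 0 c"

definition mon :: "'n pp \<Rightarrow> ('n, 'a::zero_neq_one) mpoly"
  where "mon t = Poly_Mapping.single t 1"

definition Var :: "'n \<Rightarrow> ('n, 'a::zero_neq_one) mpoly"
  where "Var i = mon (Poly_Mapping.single i 1)"

definition eval_poly :: "('n \<Rightarrow> 'a) \<Rightarrow> ('n, 'a::comm_semiring_1) mpoly \<Rightarrow> 'a"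
  where "eval_poly v p =
    (\<Sum>t\<in>Poly_Mapping.keys p. Poly_Mapping.lookup p t * (\<Prod>i\<in>Poly_Mapping.keys t. v i ^ Poly_Mapping.lookup t i))"

definition pp_deg :: "'n::finite pp \<Rightarrow> nat"
  where "pp_deg t = (\<Sum>i\<in>UNIV. Poly_Mapping.lookup t i)"

definition homogeneous_component :: "nat \<Rightarrow> ('n::finite, 'a::zero) mpoly set"
  where "homogeneous_component d = {p. \<forall>t\<in>Poly_Mapping.keys p. pp_deg t = d}"

definition K_span :: "('n, 'a::comm_ring_1) mpoly set \<Rightarrow> ('n, 'a) mpoly set"
  where "K_span = module.span (\<lambda>c p. const c * p)"


section \<open>Ideals\<close>

definition ideal :: "'r::comm_ring_1 set \<Rightarrow> 'r set"
  where "ideal = module.span (*)"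

lemma module_times: "module ((*) :: 'r::comm_ring_1 \<Rightarrow> 'r \<Rightarrow> 'r)"
  by unfold_locales (simp_all add: algebra_simps)

lemma module_const:
  "module (\<lambda>c p. const c * p :: ('n, 'a::comm_ring_1) mpoly)"
  by unfold_locales
    (simp_all add: const_def algebra_simps single_add mult_single flip: mult.assoc)

definition ideal_mult :: "'r::comm_ring_1 set \<Rightarrow> 'r set \<Rightarrow> 'r set"
  where "ideal_mult A B = ideal {a * b | a b. a \<in> A \<and> b \<in> B}"

primrec ideal_power :: "'r::comm_ring_1 set \<Rightarrow> nat \<Rightarrow> 'r set"
  where
    "ideal_power A 0 = UNIV"
  | "ideal_power A (Suc k) = ideal_mult A (ideal_power A k)"

definition monomial_ideal :: "('n, 'a::comm_ring_1) mpoly set \<Rightarrow> bool"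
  where "monomial_ideal I \<longleftrightarrow> (\<exists>T. I = ideal (mon ` T))"


section \<open>Stable ideals\<close>

text \<open>Only meaningful for power products different from 1.\<close>
definition max_var :: "'n::linorder pp \<Rightarrow> 'n"
  where "max_var t = Max (Poly_Mapping.keys t)"

definition stable_ideal :: "('n::linorder, 'a::comm_ring_1) mpoly set \<Rightarrow> bool"
  where "stable_ideal I \<longleftrightarrow> monomial_ideal I \<and>
    (\<forall>t. mon t \<in> I \<longrightarrow> t \<noteq> 0 \<longrightarrow>
      (\<forall>i \<le> max_var t.
        mon (Poly_Mapping.single i 1 + (t - Poly_Mapping.single (max_var t) 1)) \<in> I))"

definition Stable :: "'n::linorder pp \<Rightarrow> ('n, 'a::comm_ring_1) mpoly set"
  where "Stable t = stable_ideal hull {mon t}"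


section \<open>Term orderings and initial ideals\<close>

text \<open>A pair \<open>(s, t)\<close> belongs to the relation iff \<open>s\<close> is less than or equal to \<open>t\<close>.\<close>
definition term_ordering :: "'n::{finite,linorder} pp rel \<Rightarrow> bool"
  where "term_ordering \<tau> \<longleftrightarrow>
    linear_order \<tau> \<and>
    (\<forall>t. (0, t) \<in> \<tau>) \<and>
    (\<forall>s t u. (s, t) \<in> \<tau> \<longrightarrow> (s + u, t + u) \<in> \<tau>) \<and>
    (\<forall>s t. pp_deg s < pp_deg t \<longrightarrow> (s, t) \<in> \<tau>) \<and>
    (\<forall>i j. i < j \<longrightarrow> (Poly_Mapping.single j 1, Poly_Mapping.single i 1) \<in> \<tau>)"

text \<open>DegRevLex: among power products of the same degree, the smaller one is the one with the
  larger exponent at the last position where the two differ.\<close>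
definition drl :: "'n::{finite,linorder} pp rel"
  where "drl = {(s, t). pp_deg s < pp_deg t \<or>
    (pp_deg s = pp_deg t \<and>
      (s = t \<or> (\<exists>k. Poly_Mapping.lookup t k < Poly_Mapping.lookup s k \<and> (\<forall>i>k. Poly_Mapping.lookup s i = Poly_Mapping.lookup t i))))}"

definition leading_pp :: "'n pp rel \<Rightarrow> ('n, 'a::zero) mpoly \<Rightarrow> 'n pp"
  where "leading_pp \<tau> p =
    (THE t. t \<in> Poly_Mapping.keys p \<and> (\<forall>s\<in>Poly_Mapping.keys p. (s, t) \<in> \<tau>))"

definition initial_ideal :: "'n pp rel \<Rightarrow> ('n, 'a::comm_ring_1) mpoly set \<Rightarrow> ('n, 'a) mpoly set"
  where "initial_ideal \<tau> J = ideal {mon (leading_pp \<tau> p) | p. p \<in> J \<and> p \<noteq> 0}"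


section \<open>Generic initial ideals\<close>

text \<open>The \<open>K\<close>-algebra homomorphism with \<open>x\<^sub>j \<mapsto> \<Sum>\<^sub>i g\<^sub>i\<^sub>j x\<^sub>i\<close>.\<close>
definition gl_act :: "'a^'n^'n \<Rightarrow> ('n::finite, 'a::comm_ring_1) mpoly \<Rightarrow> ('n, 'a) mpoly"
  where "gl_act g p =
    (\<Sum>t\<in>Poly_Mapping.keys p.
       const (Poly_Mapping.lookup p t) * (\<Prod>j\<in>UNIV. (\<Sum>i\<in>UNIV. const (g $ i $ j) * Var i) ^ Poly_Mapping.lookup t j))"

text \<open>The Zariski topology on the invertible matrices is the subspace topology of affine space,
  whose open sets are the complements of zero sets of polynomials in the matrix entries.\<close>
definition zariski_open_GL :: "('a::field^'n^'n) set \<Rightarrow> bool"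
  where "zariski_open_GL U \<longleftrightarrow>
    (\<exists>F :: ('n \<times> 'n, 'a) mpoly set.
       U = {g. invertible g \<and> (\<exists>f\<in>F. eval_poly (\<lambda>(i, j). g $ i $ j) f \<noteq> 0)})"

text \<open>The value exists for homogeneous ideals over any infinite field, and is unique because
  nonempty Zariski-open sets meet.\<close>
definition gin ::
  "'n::{finite,linorder} pp rel \<Rightarrow> ('n, 'a::field) mpoly set \<Rightarrow> ('n, 'a) mpoly set"
  where "gin \<tau> J =
    (THE M. monomial_ideal M \<and>
      (\<exists>U. zariski_open_GL U \<and> U \<noteq> {} \<and> (\<forall>g\<in>U. initial_ideal \<tau> (gl_act g ` J) = M)))"


section \<open>Distractions\<close>

text \<open>The columns of the matrix are indexed by \<open>j \<ge> 1\<close>; the values \<open>L i 0\<close> play no role.\<close>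
definition distraction_matrix ::
  "('n::finite \<Rightarrow> nat \<Rightarrow> ('n, 'a::comm_ring_1) mpoly) \<Rightarrow> bool"
  where "distraction_matrix L \<longleftrightarrow>
    (\<forall>i. \<forall>j\<ge>1. L i j \<in> homogeneous_component 1) \<and>
    (\<forall>c. (\<forall>i. c i \<ge> 1) \<longrightarrow> K_span (range (\<lambda>i. L i (c i))) = homogeneous_component 1) \<and>
    (\<exists>N\<ge>1. \<forall>i. \<forall>j>N. L i j = L i N)"

definition distraction ::
  "('n::finite \<Rightarrow> nat \<Rightarrow> ('n, 'a::comm_ring_1) mpoly) \<Rightarrow> ('n, 'a) mpoly \<Rightarrow> ('n, 'a) mpoly"
  where "distraction L p =
    (\<Sum>t\<in>Poly_Mapping.keys p. const (Poly_Mapping.lookup p t) * (\<Prod>i\<in>UNIV. \<Prod>j=1..Poly_Mapping.lookup t i. L i j))"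

end

theory Submission
  imports Defs
begin

text \<open>
  Let \<open>d = deg t\<close>. The power products of \<open>Stable t\<close> are the \<open>s\<close> for which some \<open>j\<close> satisfies
  \<open>a\<^sub>k \<le> s\<^sub>k\<close> for \<open>k < j\<close> and \<open>s\<^sub>1 + \<dots> + s\<^sub>j \<ge> d\<close>; those of the claimed generic initial ideal \<open>J\<close>
  satisfy \<open>b\<^sub>j \<le> s\<^sub>1\<close> instead of the first condition. A coordinate change \<open>g\<close> turns the distraction
  by \<open>L\<close> into the distraction by the linear forms \<open>h i k = g (L i k)\<close>, and part (a) is the case
  \<open>L i k = x\<^sub>i\<close>. For generic \<open>g\<close>, all \<open>h i k\<close> have leading term \<open>x\<^sub>1\<close>, and the forms
  \<open>h 1 k\<^sub>1, \<dots>, h j k\<^sub>j\<close> can be reduced to \<open>x\<^sub>1, \<dots>, x\<^sub>j\<close> modulo the later variables. This shows that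
  \<open>J\<close> is contained in the initial ideal. Equality follows by counting in each degree \<open>e\<close>: the
  distraction of \<open>I\<^sub>e\<close> has dimension at most the number of power products of degree \<open>e\<close> in \<open>I\<close>,
  and these inject into the power products of degree \<open>e\<close> in \<open>J\<close>.
\<close>

text \<open>A distraction is linear but not multiplicative: which form a further factor x_i
  contributes depends on the power of x_i already present. Multiplicativity is replaced by a
  termwise operation: each term w of p may be multiplied by its own combination of the forms next in
  line for w. This is why genericity speaks of all choices of columns: different terms meet
  different columns, and splitting a factor off t leaves a distraction with shifted columns. As the
  rows of L are eventually constant, only finitely many choices differ, and genericity becomes the
  nonvanishing of one polynomial in the entries of g. Each factor of this polynomial gets its own
  witness matrix, and over an infinite field nonzero polynomial functions have a nonzero product.
  The same fact makes \<open>gin\<close>, which is a definite description, well defined. The choice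
  \<open>L i k = Var i\<close> has constant rows, which is what leaves the ordering arbitrary in
  part (a).\<close>

abbreviation lookup :: "('b \<Rightarrow>\<^sub>0 'c::zero) \<Rightarrow> 'b \<Rightarrow> 'c"
  where "lookup \<equiv> Poly_Mapping.lookup"

abbreviation keys :: "('b \<Rightarrow>\<^sub>0 'c::zero) \<Rightarrow> 'b set"
  where "keys \<equiv> Poly_Mapping.keys"

abbreviation single :: "'b \<Rightarrow> 'c \<Rightarrow> 'b \<Rightarrow>\<^sub>0 'c::zero"
  where "single \<equiv> Poly_Mapping.single"

section \<open>Polynomials as sums of their terms\<close>

lemma sum_single_keys: "(\<Sum>t\<in>keys p. single t (lookup p t)) = p"
proof (rule poly_mapping_eqI)
  fix k
  have "lookup (\<Sum>t\<in>keys p. single t (lookup p t)) k = (\<Sum>t\<in>keys p. if t = k then lookup p k else 0)"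
    by (auto simp: lookup_sum lookup_single when_def intro!: sum.cong)
  also have "\<dots> = lookup p k"
    by (auto simp: in_keys_iff)
  finally show "lookup (\<Sum>t\<in>keys p. single t (lookup p t)) k = lookup p k" .
qed

lemma poly_mapping_single_induct [case_names zero add single]:
  fixes p :: "'b \<Rightarrow>\<^sub>0 'c::comm_monoid_add"
  assumes "P 0" "\<And>p q. P p \<Longrightarrow> P q \<Longrightarrow> P (p + q)" "\<And>t a. P (single t a)"
  shows "P p"
proof -
  have "P (\<Sum>t\<in>A. single t (lookup p t))" if "finite A" for A
    using that by (induction A rule: finite_induct) (simp_all add: assms)
  then show ?thesis
    by (metis finite_keys sum_single_keys)
qed

lemma const_0 [simp]: "const 0 = 0"
  and const_1 [simp]: "const 1 = (1 :: ('n, 'a::comm_ring_1) mpoly)"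
  and const_add: "const (a + b) = const a + (const b :: ('n, 'a::comm_ring_1) mpoly)"
  and const_mult: "const (a * b) = const a * (const b :: ('n, 'a::comm_ring_1) mpoly)"
  by (simp_all add: const_def single_add mult_single)

lemma const_times_single: "const a * single t b = single t (a * b :: 'a::comm_ring_1)"
  by (simp add: const_def mult_single)

lemma const_times_mon: "const a * mon t = single t (a :: 'a::comm_ring_1)"
  by (simp add: mon_def const_times_single)

lemma lookup_const_times: "lookup (const a * p) t = a * lookup p (t :: 'n pp)"
  for a :: "'a::comm_ring_1"
proof (induction p rule: poly_mapping_single_induct)
  case (single s b)
  then show ?case by (simp add: const_times_single lookup_single when_def)
qed (simp_all add: distrib_left lookup_add)

lemma sum_mon_keys: "(\<Sum>t\<in>keys p. const (lookup p t) * mon t) = (p :: ('n, 'a::comm_ring_1) mpoly)"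
  by (simp add: const_times_mon sum_single_keys)

lemma mon_add: "mon (s + t) = mon s * (mon t :: ('n, 'a::comm_ring_1) mpoly)"
  by (simp add: mon_def mult_single)

lemma mon_0 [simp]: "mon 0 = (1 :: ('n, 'a::comm_ring_1) mpoly)"
  by (simp add: mon_def)

lemma keys_mon [simp]: "keys (mon t :: ('n, 'a::comm_ring_1) mpoly) = {t}"
  by (simp add: mon_def)


section \<open>Linear extensions\<close>

text \<open>Common form of \<open>distraction\<close> and \<open>gl_act\<close> (with
  \<open>f = const\<close>) and of \<open>eval_poly\<close> (with the identity), so that linearity
  and multiplicativity are proved once for all three.\<close>

definition lin_ext :: "('a::comm_ring_1 \<Rightarrow> 'r::comm_ring_1) \<Rightarrow> ('n pp \<Rightarrow> 'r) \<Rightarrow> ('n, 'a) mpoly \<Rightarrow> 'r"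
  where "lin_ext f \<Phi> p = (\<Sum>t\<in>keys p. f (lookup p t) * \<Phi> t)"

definition coeff_hom :: "('a::comm_ring_1 \<Rightarrow> 'r::comm_ring_1) \<Rightarrow> bool"
  where "coeff_hom f \<longleftrightarrow> f 0 = 0 \<and> f 1 = 1 \<and> (\<forall>a b. f (a + b) = f a + f b) \<and> (\<forall>a b. f (a * b) = f a * f b)"

lemma coeff_hom_const: "coeff_hom (const :: 'a::comm_ring_1 \<Rightarrow> ('n, 'a) mpoly)"
  by (simp add: coeff_hom_def const_add const_mult)

lemma coeff_hom_id: "coeff_hom (\<lambda>x. x)"
  by (simp add: coeff_hom_def)

lemma lin_ext_superset:
  assumes "coeff_hom f" "finite A" "keys p \<subseteq> A"
  shows "lin_ext f \<Phi> p = (\<Sum>t\<in>A. f (lookup p t) * \<Phi> t)"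
  unfolding lin_ext_def using assms
  by (intro sum.mono_neutral_left) (auto simp: in_keys_iff coeff_hom_def)

lemma lin_ext_0 [simp]: "lin_ext f \<Phi> 0 = 0"
  by (simp add: lin_ext_def)

lemma lin_ext_add:
  assumes "coeff_hom f"
  shows "lin_ext f \<Phi> (p + q) = lin_ext f \<Phi> p + lin_ext f \<Phi> q"
proof -
  have "lin_ext f \<Phi> r = (\<Sum>t\<in>keys p \<union> keys q. f (lookup r t) * \<Phi> t)" if "r \<in> {p, q, p + q}" for r
    using that keys_add[of p q] by (intro lin_ext_superset[OF assms]) auto
  then show ?thesis
    using assms by (simp add: coeff_hom_def lookup_add distrib_right sum.distrib)
qed

lemma lin_ext_single:
  assumes "coeff_hom f"
  shows "lin_ext f \<Phi> (single t a) = f a * \<Phi> t"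
  using lin_ext_superset[OF assms, of "{t}" "single t a"] by simp

lemma lin_ext_mon:
  assumes "coeff_hom f"
  shows "lin_ext f \<Phi> (mon t) = \<Phi> t"
  using assms by (simp add: mon_def lin_ext_single) (simp add: coeff_hom_def)

lemma lin_ext_const_times:
  assumes "coeff_hom f"
  shows "lin_ext f \<Phi> (const a * p) = f a * lin_ext f \<Phi> p"
proof (induction p rule: poly_mapping_single_induct)
  case (single t b)
  then show ?case
    using assms by (simp add: const_times_single lin_ext_single) (simp add: coeff_hom_def mult.assoc)
qed (simp_all add: lin_ext_add[OF assms] distrib_left)

lemma lin_ext_sum:
  assumes "coeff_hom f"
  shows "lin_ext f \<Phi> (sum p A) = (\<Sum>x\<in>A. lin_ext f \<Phi> (p x))"
  by (induction A rule: infinite_finite_induct) (simp_all add: lin_ext_add[OF assms])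

text \<open>Two maps are allowed because splitting a factor off a distraction shifts the columns of
  the forms; for multiplicative \<Phi> the maps coincide.\<close>

lemma lin_ext_mon_times:
  assumes "coeff_hom f" "\<And>t. \<Phi> (s + t) = x * \<Psi> t"
  shows "lin_ext f \<Phi> (mon s * p) = x * lin_ext f \<Psi> p"
proof (induction p rule: poly_mapping_single_induct)
  case (single t b)
  then show ?case
    by (simp add: mon_def mult_single lin_ext_single[OF assms(1)] assms(2) ac_simps)
qed (simp_all add: lin_ext_add[OF assms(1)] distrib_left)

lemma lin_ext_mult:
  assumes "coeff_hom f" "\<And>s t. \<Phi> (s + t) = \<Phi> s * \<Phi> t"
  shows "lin_ext f \<Phi> (p * q) = lin_ext f \<Phi> p * lin_ext f \<Phi> q"
proof (induction p rule: poly_mapping_single_induct)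
  case (single s a)
  have "lin_ext f \<Phi> (single s a * q) = lin_ext f \<Phi> (const a * (mon s * q))"
    by (simp add: const_times_mon flip: mult.assoc)
  then show ?case
    by (simp add: lin_ext_const_times[OF assms(1)] lin_ext_mon_times[of f \<Phi> s "\<Phi> s" \<Phi>, OF assms] lin_ext_single[OF assms(1)] mult.assoc)
qed (simp_all add: lin_ext_add[OF assms(1)] distrib_right)


section \<open>Monomial ideals\<close>

lemma ideal_base: "x \<in> A \<Longrightarrow> x \<in> ideal A"
  and ideal_scale: "x \<in> ideal A \<Longrightarrow> r * x \<in> ideal A"
  and ideal_sum: "(\<And>i. i \<in> B \<Longrightarrow> f i \<in> ideal A) \<Longrightarrow> sum f B \<in> ideal A"
  unfolding ideal_def
  by (simp_all add: module.span_base[OF module_times] module.span_scale[OF module_times]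
      module.span_sum[OF module_times])

lemma ideal_least:
  assumes "A \<subseteq> J" "0 \<in> J" "\<And>x y. x \<in> J \<Longrightarrow> y \<in> J \<Longrightarrow> x + y \<in> J" "\<And>r x. x \<in> J \<Longrightarrow> r * x \<in> J"
  shows "ideal A \<subseteq> J"
  unfolding ideal_def
  by (intro module.span_minimal[OF module_times] module.subspaceI[OF module_times]) (use assms in auto)

text \<open>Up closed sets \<open>M\<close> give the monomial ideals; other sets, such as all power
  products of one degree, give the graded pieces.\<close>

definition mon_space :: "'n pp set \<Rightarrow> ('n, 'a::comm_ring_1) mpoly set"
  where "mon_space M = {p. keys p \<subseteq> M}"

definition up_closed :: "'n pp set \<Rightarrow> bool"
  where "up_closed M \<longleftrightarrow> (\<forall>s\<in>M. \<forall>r. r + s \<in> M)"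

lemma mon_space_0: "0 \<in> mon_space M"
  and mon_space_add: "p \<in> mon_space M \<Longrightarrow> q \<in> mon_space M \<Longrightarrow> p + q \<in> mon_space M"
  using keys_add[of p q] by (auto simp: mon_space_def)

lemma mon_space_mult: "up_closed M \<Longrightarrow> q \<in> mon_space M \<Longrightarrow> p * q \<in> mon_space M"
  using keys_mult[of p q] unfolding mon_space_def up_closed_def by blast

lemma mon_in_mon_space [simp]: "(mon t :: ('n, 'a::comm_ring_1) mpoly) \<in> mon_space M \<longleftrightarrow> t \<in> M"
  by (simp add: mon_space_def)

lemma mon_space_sum: "(\<And>x. x \<in> A \<Longrightarrow> f x \<in> mon_space M) \<Longrightarrow> sum f A \<in> mon_space M"
  by (induction A rule: infinite_finite_induct) (simp_all add: mon_space_0 mon_space_add)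

lemma mon_space_const_mult: "q \<in> mon_space M \<Longrightarrow> const c * q \<in> mon_space M"
  
  unfolding mon_space_def
  by (smt (verit) in_keys_iff lookup_const_times mem_Collect_eq mult_zero_right subset_iff)

lemma mon_space_subset_ideal:
  assumes "\<And>t. t \<in> M \<Longrightarrow> mon t \<in> ideal A"
  shows "mon_space M \<subseteq> ideal A"
proof
  fix p :: "('a, 'b) mpoly" assume "p \<in> mon_space M"
  then have "(\<Sum>t\<in>keys p. const (lookup p t) * mon t) \<in> ideal A"
    using assms by (intro ideal_sum ideal_scale) (auto simp: mon_space_def)
  then show "p \<in> ideal A"
    by (simp add: sum_mon_keys)
qed

lemma ideal_subset_mon_space: "up_closed M \<Longrightarrow> A \<subseteq> mon_space M \<Longrightarrow> ideal A \<subseteq> mon_space M"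
  by (intro ideal_least) (auto intro: mon_space_0 mon_space_add mon_space_mult)

lemma ideal_mon_up_closed: "up_closed M \<Longrightarrow> ideal (mon ` M) = mon_space M"
  by (intro equalityI ideal_subset_mon_space mon_space_subset_ideal) (auto intro: ideal_base)

lemma monomial_ideal_mon_space: "up_closed M \<Longrightarrow> monomial_ideal (mon_space M)"
  unfolding monomial_ideal_def by (metis ideal_mon_up_closed)

lemma up_closed_multiples: "up_closed {r + s | r s. s \<in> T}"
  unfolding up_closed_def
proof (intro ballI allI)
  fix u v assume "u \<in> {r + s | r s. s \<in> T}"
  then obtain r s where "u = r + s" "s \<in> T" by auto
  then have "v + u = (v + r) + s" by (simp add: add.assoc)
  with \<open>s \<in> T\<close> show "v + u \<in> {r + s | r s. s \<in> T}" by blast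
qed

lemma ideal_mon: "ideal (mon ` T) = mon_space {r + s | r s. s \<in> T}"
proof (intro equalityI ideal_subset_mon_space mon_space_subset_ideal)
  show "up_closed {r + s | r s. s \<in> T}"
    by (rule up_closed_multiples)
next
  show "mon ` T \<subseteq> mon_space {r + s | r s. s \<in> T}"
  proof safe
    fix t assume "t \<in> T"
    then have "t \<in> {r + s | r s. s \<in> T}"
      by (intro CollectI exI[of _ 0] exI[of _ t]) simp
    then show "mon t \<in> mon_space {r + s | r s. s \<in> T}" by simp
  qed
next
  fix t assume "t \<in> {r + s | r s. s \<in> T}"
  then obtain r s where "t = r + s" "s \<in> T" by auto
  then show "(mon t :: ('a, 'b) mpoly) \<in> ideal (mon ` T)"
    by (simp add: mon_add ideal_scale ideal_base)
qed

lemma ideal_mult_mon_space: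
  assumes "up_closed M" "up_closed N"
  shows "ideal_mult (mon_space M) (mon_space N) = (mon_space {s + t | s t. s \<in> M \<and> t \<in> N} :: ('n, 'a::comm_ring_1) mpoly set)"
  unfolding ideal_mult_def
proof (intro equalityI ideal_subset_mon_space mon_space_subset_ideal)
  show "up_closed {s + t | s t. s \<in> M \<and> t \<in> N}"
    unfolding up_closed_def
  proof (intro ballI allI)
    fix u v assume "u \<in> {s + t | s t. s \<in> M \<and> t \<in> N}"
    then obtain s t where "u = s + t" "s \<in> M" "t \<in> N" by auto
    moreover from this have "v + u = (v + s) + t" by (simp add: add.assoc)
    ultimately show "v + u \<in> {s + t | s t. s \<in> M \<and> t \<in> N}"
      using assms(1) unfolding up_closed_def by blast
  qed
next
  show "{a * b | a b. a \<in> mon_space M \<and> b \<in> mon_space N} \<subseteq> (mon_space {s + t | s t. s \<in> M \<and> t \<in> N} :: ('n, 'a) mpoly set)"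
  proof
    fix x :: "('n, 'a) mpoly" assume "x \<in> {a * b | a b. a \<in> mon_space M \<and> b \<in> mon_space N}"
    then obtain a b where "x = a * b" "a \<in> mon_space M" "b \<in> mon_space N" by auto
    with keys_mult[of a b] show "x \<in> mon_space {s + t | s t. s \<in> M \<and> t \<in> N}"
      unfolding mon_space_def by blast
  qed
next
  fix u assume "u \<in> {s + t | s t. s \<in> M \<and> t \<in> N}"
  then obtain s t where "u = s + t" "s \<in> M" "t \<in> N" by auto
  then show "(mon u :: ('n, 'a) mpoly) \<in> ideal {a * b | a b. a \<in> mon_space M \<and> b \<in> mon_space N}"
    by (intro ideal_base CollectI exI[of _ "mon s"] exI[of _ "mon t"]) (simp add: mon_add)
qed

lemma mon_space_plus:
  fixes M N :: "'n pp set"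
  shows "(mon_space M :: ('n, 'a::comm_ring_1) mpoly set) + mon_space N = mon_space (M \<union> N)"
proof (intro equalityI subsetI)
  fix x :: "('n, 'a) mpoly" assume "x \<in> mon_space M + mon_space N"
  then obtain p q where "x = p + q" "keys p \<subseteq> M" "keys q \<subseteq> N"
    by (auto simp: set_plus_def mon_space_def)
  then show "x \<in> mon_space (M \<union> N)"
    using keys_add[of p q] by (auto simp: mon_space_def)
next
  fix x :: "('n, 'a) mpoly" assume x: "x \<in> mon_space (M \<union> N)"
  define p where "p = (\<Sum>t\<in>keys x \<inter> M. const (lookup x t) * mon t)"
  define q where "q = (\<Sum>t\<in>keys x - M. const (lookup x t) * mon t)"
  have "p + q = (\<Sum>t\<in>keys x. const (lookup x t) * mon t)"
    unfolding p_def q_def by (subst sum.union_disjoint[symmetric]) (auto intro!: sum.cong)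
  then have "x = p + q"
    by (simp add: sum_mon_keys)
  moreover have "keys x - M \<subseteq> N"
    using x by (auto simp: mon_space_def)
  then have "p \<in> mon_space M" "q \<in> mon_space N"
    unfolding p_def q_def
    by (auto intro!: mon_space_sum mon_space_const_mult simp del: Diff_iff)
  ultimately show "x \<in> mon_space M + mon_space N"
    by (auto simp: set_plus_def)
qed

lemma sum_mon_space:
  assumes "finite A"
  shows "(\<Sum>j\<in>A. mon_space (M j)) = mon_space (\<Union>j\<in>A. M j)"
  using assms
proof (induction A rule: finite_induct)
  case empty
  then show ?case by (auto simp: mon_space_def)
qed (simp_all add: mon_space_plus)


section \<open>Power products\<close>

lemma pp_deg_add: "pp_deg (s + t) = pp_deg s + pp_deg t"
  by (simp add: pp_deg_def lookup_add sum.distrib)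

lemma pp_deg_0 [simp]: "pp_deg 0 = 0"
  by (simp add: pp_deg_def)

lemma sum_lookup_single: "finite A \<Longrightarrow> (\<Sum>k\<in>A. lookup (single i c) k) = (if i \<in> A then c else 0)"
  for c :: nat
  by (simp add: lookup_single when_def)

lemma pp_deg_single [simp]: "pp_deg (single i c) = c"
  by (simp add: pp_deg_def sum_lookup_single)

lemma pp_deg_eq_0_iff: "pp_deg t = 0 \<longleftrightarrow> t = 0"
  by (auto simp: pp_deg_def intro: poly_mapping_eqI)

lemma pp_diff_add: "(\<And>k. lookup s k \<le> lookup u k) \<Longrightarrow> (u - s) + s = u"
  for s u :: "'n pp"
  by (rule poly_mapping_eqI) (simp add: lookup_add lookup_minus)

definition pp_of :: "('n::finite \<Rightarrow> nat) \<Rightarrow> 'n pp"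
  where "pp_of f = Abs_poly_mapping f"

lemma lookup_pp_of [simp]: "lookup (pp_of f) = f"
  by (simp add: pp_of_def)

lemma finite_pp_deg: "finite {s :: 'n::finite pp. pp_deg s = e}"
proof (rule finite_imageD[of lookup])
  have "lookup s k \<le> pp_deg s" for s :: "'n pp" and k
    unfolding pp_deg_def by (rule member_le_sum) auto
  then have "lookup ` {s :: 'n pp. pp_deg s = e} \<subseteq> (\<Pi>\<^sub>E k\<in>UNIV. {..e})"
    by auto
  then show "finite (lookup ` {s :: 'n pp. pp_deg s = e})"
    by (rule finite_subset) (intro finite_PiE; simp)
  show "inj_on lookup {s :: 'n pp. pp_deg s = e}"
    by (simp add: inj_on_def)
qed

text \<open>While the degree of \<open>l\<close> is below \<open>d\<close>, some exponent of
  \<open>l\<close> is smaller than that of \<open>r\<close> and can be raised by one. This supplies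
  the divisors of degree \<open>pp_deg t\<close> through which the elements of
  \<open>stable_pps t\<close> and \<open>gin_pps t\<close> are reached.\<close>

lemma pp_between:
  fixes l r :: "'n::finite pp"
  assumes "\<And>k. lookup l k \<le> lookup r k" "pp_deg l \<le> d" "d \<le> pp_deg r"
  obtains u where "\<And>k. lookup l k \<le> lookup u k" "\<And>k. lookup u k \<le> lookup r k" "pp_deg u = d"
proof -
  have "\<exists>u. (\<forall>k. lookup l k \<le> lookup u k \<and> lookup u k \<le> lookup r k) \<and> pp_deg u = d"
    using assms
  proof (induction "d - pp_deg l" arbitrary: l)
    case 0
    then show ?case by (intro exI[of _ l]) auto
  next
    case (Suc n)
    have "\<exists>i. lookup l i < lookup r i"
    proof (rule ccontr)
      assume "\<nexists>i. lookup l i < lookup r i"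
      then have "pp_deg r \<le> pp_deg l"
        unfolding pp_deg_def by (intro sum_mono) (simp add: not_less)
      with Suc show False by linarith
    qed
    then obtain i where i: "lookup l i < lookup r i" by auto
    have deg: "pp_deg (single i 1 + l) = Suc (pp_deg l)"
      by (simp add: pp_deg_add)
    have "lookup (single i 1 + l) k \<le> lookup r k" for k
      using i Suc(3)[of k] by (auto simp: lookup_add lookup_single when_def)
    then obtain u where "\<forall>k. lookup (single i 1 + l) k \<le> lookup u k \<and> lookup u k \<le> lookup r k" "pp_deg u = d"
      using Suc.hyps(1)[of "single i 1 + l"] Suc.hyps(2) Suc.prems(3) deg by fastforce
    then show ?case
      by (intro exI[of _ u]) (auto simp: lookup_add intro: add_leE)
  qed
  then show ?thesis using that by blast
qed

definition head :: "'n::{finite,linorder} \<Rightarrow> 'n pp \<Rightarrow> 'n pp"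
  where "head j t = pp_of (\<lambda>k. if k < j then lookup t k else 0)"

lemma lookup_head: "lookup (head j t) k = (if k < j then lookup t k else 0)"
  by (simp add: head_def)

lemma sum_head: "finite A \<Longrightarrow> (\<Sum>k\<in>A. lookup (head j t) k) = (\<Sum>k\<in>A \<inter> {..<j}. lookup t k)"
  by (simp add: lookup_head sum.inter_restrict)

lemma pp_deg_head: "pp_deg (head j t) = (\<Sum>k<j. lookup t k)"
  by (simp add: pp_deg_def sum_head)

lemma pp_deg_split: "pp_deg t = (\<Sum>k<j. lookup t k) + (\<Sum>k | j \<le> k. lookup t k)"
  for j :: "'n::{finite,linorder}"
  unfolding pp_deg_def by (subst sum.union_disjoint[symmetric]) (auto intro!: sum.cong)

lemma Min_UNIV_le [simp]: "Min UNIV \<le> (k :: 'n::{finite,linorder})"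
  by simp


section \<open>The stable ideal generated by a power product\<close>

definition stable_pps :: "'n::{finite,linorder} pp \<Rightarrow> 'n pp set"
  where "stable_pps t = {s. \<exists>j. (\<forall>k<j. lookup t k \<le> lookup s k) \<and> pp_deg t \<le> (\<Sum>k\<le>j. lookup s k)}"

definition gin_pps :: "'n::{finite,linorder} pp \<Rightarrow> 'n pp set"
  where "gin_pps t = {s. \<exists>j. (\<Sum>k<j. lookup t k) \<le> lookup s (Min UNIV) \<and> pp_deg t \<le> (\<Sum>k\<le>j. lookup s k)}"

lemma up_closed_stable_pps: "up_closed (stable_pps t)"
  unfolding up_closed_def stable_pps_def
  by (auto simp: lookup_add sum.distrib intro!: trans_le_add2)

lemma up_closed_gin_pps: "up_closed (gin_pps t)"
  unfolding up_closed_def gin_pps_def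
  by (auto simp: lookup_add sum.distrib intro!: trans_le_add2)

lemma max_var_properties:
  fixes s :: "'n::{finite,linorder} pp"
  assumes "s \<noteq> 0"
  shows "lookup s (max_var s) > 0" "max_var s < k \<Longrightarrow> lookup s k = 0"
proof -
  have "max_var s \<in> keys s"
    unfolding max_var_def using assms by (intro Max_in) auto
  then show "lookup s (max_var s) > 0" by (simp add: in_keys_iff)
  show "lookup s k = 0" if "max_var s < k"
    using that unfolding max_var_def
    by (metis Max_ge finite_keys in_keys_iff not_less)
qed

lemma max_var_eqI:
  fixes s :: "'n::{finite,linorder} pp"
  assumes "lookup s m > 0" "\<And>k. m < k \<Longrightarrow> lookup s k = 0"
  shows "max_var s = m"
  unfolding max_var_def using assms by (intro Max_eqI) (auto simp: in_keys_iff intro: leI)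

text \<open>The exchange can lower only the exponent at \<open>m = max_var s\<close> and, as
  \<open>i \<le> m\<close>, lowers no partial sum. If \<open>m \<ge> j\<close>, the index
  \<open>j\<close> still works. If \<open>m < j\<close>, no variable beyond \<open>m\<close> occurs
  in \<open>s\<close>, so the partial sums up to \<open>m\<close> and up to \<open>j\<close> agree
  and \<open>m\<close> works instead: its condition leaves the exponent at \<open>m\<close>
  free.\<close>

lemma stable_pps_exchange:
  fixes s t :: "'n::{finite,linorder} pp"
  assumes s: "s \<in> stable_pps t" "s \<noteq> 0" and i: "i \<le> max_var s"
  shows "single i 1 + (s - single (max_var s) 1) \<in> stable_pps t"
proof -
  define m where "m = max_var s"
  define s' where "s' = single i 1 + (s - single m 1)"
  have pos: "lookup s m > 0" and zero: "\<And>k. m < k \<Longrightarrow> lookup s k = 0"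
    using max_var_properties[OF s(2)] by (auto simp: m_def)
  have ge: "lookup s k \<le> lookup s' k" if "k \<noteq> m" for k
    using that by (simp add: s'_def lookup_add lookup_minus lookup_single_not_eq)
  have "s' + single m 1 = s + single i 1"
    using pos unfolding s'_def
    by (intro poly_mapping_eqI) (auto simp: lookup_add lookup_minus lookup_single when_def)
  then have eq: "(\<Sum>k\<le>l. lookup (s' + single m 1) k) = (\<Sum>k\<le>l. lookup (s + single i 1) k)" for l
    by simp
  have sums: "(\<Sum>k\<le>l. lookup s' k) + (if m \<le> l then 1 else 0) = (\<Sum>k\<le>l. lookup s k) + (if i \<le> l then 1 else 0)" for l
    using eq[of l] by (simp add: lookup_add sum.distrib sum_lookup_single split: if_splits)
  have sums_ge: "(\<Sum>k\<le>l. lookup s k) \<le> (\<Sum>k\<le>l. lookup s' k)" for l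
    using sums[of l] i by (auto simp: m_def split: if_splits)
  from s(1) obtain j where j: "\<forall>k<j. lookup t k \<le> lookup s k" "pp_deg t \<le> (\<Sum>k\<le>j. lookup s k)"
    by (auto simp: stable_pps_def)
  have "s' \<in> stable_pps t"
  proof (cases "m < j")
    case False
    then have "\<forall>k<j. lookup t k \<le> lookup s' k"
      using j(1) ge by (metis order.strict_iff_not order_trans)
    then show ?thesis
      using j(2) sums_ge[of j] unfolding stable_pps_def by force
  next
    case True
    have "(\<Sum>k\<le>j. lookup s k) = (\<Sum>k\<le>m. lookup s k)"
      using True zero by (intro sum.mono_neutral_right) (auto simp: not_le[symmetric])
    moreover have "\<forall>k<m. lookup t k \<le> lookup s' k"
      using j(1) ge True by (metis order.strict_iff_not order_trans order.strict_trans)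
    ultimately show ?thesis
      using j(2) sums_ge[of m] unfolding stable_pps_def by force
  qed
  then show ?thesis by (simp add: s'_def m_def)
qed

lemma stable_ideal_mon_space_stable_pps:
  "stable_ideal (mon_space (stable_pps t) :: ('n::{finite,linorder}, 'a::comm_ring_1) mpoly set)"
  unfolding stable_ideal_def
  by (auto simp: monomial_ideal_mon_space up_closed_stable_pps stable_pps_exchange[unfolded One_nat_def])

text \<open>The exchange is run backwards from \<open>s\<close>: a variable x_i in excess over
  \<open>t\<close> is replaced by the first deficient variable x_m. Then x_m is the last variable of
  the result, and exchanging it for x_i returns \<open>s\<close>. The measure is the total excess
  over \<open>t\<close>; truncated subtraction discards the deficits.\<close>

lemma stable_ideal_contains:
  fixes t :: "'n::{finite,linorder} pp" and A :: "('n, 'a::comm_ring_1) mpoly set"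
  assumes A: "stable_ideal A" "mon t \<in> A"
    and s: "pp_deg s = pp_deg t" "\<And>k. j < k \<Longrightarrow> lookup s k = 0" "\<And>k. k < j \<Longrightarrow> lookup t k \<le> lookup s k"
  shows "mon s \<in> A"
  using s
proof (induction "\<Sum>k\<in>UNIV. lookup s k - lookup t k" arbitrary: s j rule: less_induct)
  case less
  show ?case
  proof (cases "s = t")
    case False
    have "\<exists>i. lookup t i < lookup s i"
    proof (rule ccontr)
      assume "\<nexists>i. lookup t i < lookup s i"
      then have "lookup s k = lookup t k" for k
        using less.prems(1) sum_mono_inv[of "lookup s" UNIV "lookup t" k] unfolding pp_deg_def
        by (simp add: not_less)
      with False show False by (simp add: poly_mapping_eqI)
    qed
    then obtain i where i: "lookup t i < lookup s i" by auto
    have "\<exists>m. lookup s m < lookup t m"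
    proof (rule ccontr)
      assume "\<nexists>m. lookup s m < lookup t m"
      then have "lookup t k = lookup s k" for k
        using less.prems(1) sum_mono_inv[of "lookup t" UNIV "lookup s" k] unfolding pp_deg_def
        by (simp add: not_less)
      with False show False by (simp add: poly_mapping_eqI)
    qed
    then have ne: "{m. lookup s m < lookup t m} \<noteq> {}" by auto
    \<comment> \<open>Minimality lets the new power product satisfy the hypotheses with
      \<open>m\<close> in place of \<open>j\<close>. Deficits occur only from \<open>j\<close> on
      and excesses only up to \<open>j\<close>, whence \<open>i < m\<close>.\<close>
    define m where "m = Min {m. lookup s m < lookup t m}"
    have m: "lookup s m < lookup t m"
      using Min_in[OF _ ne] by (simp add: m_def)
    have m_min: "lookup t k \<le> lookup s k" if "k < m" for k
    proof (rule ccontr)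
      assume "\<not> lookup t k \<le> lookup s k"
      then have "m \<le> k" unfolding m_def by (intro Min_le) auto
      with that show False by simp
    qed
    have "j \<le> m"
      using m less.prems(3)[of m] by force
    have "i \<le> j"
      using i less.prems(2)[of i] by force
    have "i \<noteq> m" using i m by auto
    with \<open>i \<le> j\<close> \<open>j \<le> m\<close> have "i < m" by auto
    define s' where "s' = single m 1 + (s - single i 1)"
    have eq: "s' + single i 1 = s + single m 1"
      using i unfolding s'_def
      by (intro poly_mapping_eqI) (auto simp: lookup_add lookup_minus lookup_single when_def)
    then have "pp_deg (s' + single i 1) = pp_deg (s + single m 1)" by simp
    then have deg: "pp_deg s' = pp_deg t"
      using less.prems(1) by (simp add: pp_deg_add)
    have s'_i: "lookup s' i = lookup s i - 1" and s'_m: "lookup s' m = Suc (lookup s m)"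
      and s'_k: "\<And>k. k \<noteq> i \<Longrightarrow> k \<noteq> m \<Longrightarrow> lookup s' k = lookup s k"
      using \<open>i \<noteq> m\<close> by (auto simp: s'_def lookup_add lookup_minus lookup_single when_def)
    have zero: "lookup s' k = 0" if "m < k" for k
      using that \<open>i < m\<close> \<open>j \<le> m\<close> less.prems(2)[of k] s'_k[of k] by auto
    have "mon s' \<in> A"
    proof (rule less.hyps[of s' m])
      show "(\<Sum>k\<in>UNIV. lookup s' k - lookup t k) < (\<Sum>k\<in>UNIV. lookup s k - lookup t k)"
      proof (rule sum_strict_mono_ex1)
        show "\<forall>k\<in>UNIV. lookup s' k - lookup t k \<le> lookup s k - lookup t k"
        proof
          fix k show "lookup s' k - lookup t k \<le> lookup s k - lookup t k"
            using s'_i s'_m s'_k[of k] m by (cases "k = i"; cases "k = m") auto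
        qed
        show "\<exists>k\<in>UNIV. lookup s' k - lookup t k < lookup s k - lookup t k"
          using s'_i i by (intro bexI[of _ i]) auto
      qed simp
      show "pp_deg s' = pp_deg t" by (rule deg)
      show "lookup s' k = 0" if "m < k" for k by (rule zero[OF that])
      show "lookup t k \<le> lookup s' k" if "k < m" for k
        using that i m_min[OF that] s'_i s'_k[of k] by (cases "k = i") auto
    qed
    moreover have "max_var s' = m"
      using s'_m zero by (intro max_var_eqI) auto
    moreover have "s' \<noteq> 0" using s'_m by auto
    ultimately have "mon (single i 1 + (s' - single m 1)) \<in> A"
      using A(1) \<open>i < m\<close> unfolding stable_ideal_def by (metis order_less_imp_le)
    moreover have "single i 1 + (s' - single m 1) = s"
      using i \<open>i \<noteq> m\<close> unfolding s'_def
      by (intro poly_mapping_eqI) (auto simp: lookup_add lookup_minus lookup_single when_def)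
    ultimately show ?thesis by simp
  qed (simp add: A)
qed

text \<open>For minimality, a power product \<open>s\<close> with index \<open>j\<close> is a
  multiple of some \<open>u\<close> of degree \<open>pp_deg t\<close> lying between
  \<open>head j t\<close> and the part of \<open>s\<close> in x_1, ..., x_j; this \<open>u\<close>
  is reached from \<open>t\<close> by exchanges.\<close>

lemma Stable_eq:
  "Stable t = (mon_space (stable_pps t) :: ('n::{finite,linorder}, 'a::comm_ring_1) mpoly set)"
  unfolding Stable_def
proof (rule hull_unique)
  have "t \<in> stable_pps t"
    unfolding stable_pps_def pp_deg_def
    by (auto intro!: exI[of _ "Max UNIV"] sum_mono2)
  then show "{mon t} \<subseteq> mon_space (stable_pps t)" by simp
  show "stable_ideal (mon_space (stable_pps t))"
    by (rule stable_ideal_mon_space_stable_pps)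
next
  fix A :: "('n, 'a) mpoly set" assume A: "{mon t} \<subseteq> A" "stable_ideal A"
  then obtain T where T: "A = ideal (mon ` T)"
    by (auto simp: stable_ideal_def monomial_ideal_def)
  show "mon_space (stable_pps t) \<subseteq> A"
    unfolding T
  proof (rule mon_space_subset_ideal)
    fix s assume "s \<in> stable_pps t"
    then obtain j where j: "\<forall>k<j. lookup t k \<le> lookup s k" "pp_deg t \<le> (\<Sum>k\<le>j. lookup s k)"
      by (auto simp: stable_pps_def)
    define r where "r = pp_of (\<lambda>k. if k \<le> j then lookup s k else 0)"
    have "pp_deg r = (\<Sum>k\<le>j. lookup s k)"
      unfolding pp_deg_def r_def
    using sum.inter_restrict[of UNIV "lookup s" "{..j}"] by simp
    moreover have "lookup (head j t) k \<le> lookup r k" for k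
      using j(1) by (simp add: lookup_head r_def less_imp_le)
    moreover have "pp_deg (head j t) \<le> pp_deg t"
      by (simp add: pp_deg_head pp_deg_split[of t j])
    ultimately obtain u where u: "\<And>k. lookup (head j t) k \<le> lookup u k" "\<And>k. lookup u k \<le> lookup r k"
      "pp_deg u = pp_deg t"
      using j(2) pp_between[of "head j t" r "pp_deg t"] by auto
    have "mon u \<in> A"
    proof (rule stable_ideal_contains[of A t])
      show "lookup u k = 0" if "j < k" for k
        using u(2)[of k] that by (simp add: r_def leD split: if_splits)
      show "lookup t k \<le> lookup u k" if "k < j" for k
        using u(1)[of k] that by (simp add: lookup_head)
    qed (use A u in auto)
    moreover have "lookup u k \<le> lookup s k" for k
      using u(2)[of k] by (simp add: r_def split: if_splits)
    then have "s = (s - u) + u" by (simp add: pp_diff_add)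
    then have "mon s = mon (s - u) * (mon u :: ('n, 'a) mpoly)"
      by (metis mon_add)
    ultimately show "(mon s :: ('n, 'a) mpoly) \<in> ideal (mon ` T)"
      by (simp add: T ideal_scale)
  qed
qed


section \<open>The candidate for the generic initial ideal\<close>

lemma ideal_Var_power:
  "ideal {Var m ^ b} = (mon_space {s. b \<le> lookup s m} :: ('n, 'a::comm_ring_1) mpoly set)"
proof -
  have "Var m ^ b = (mon (single m b) :: ('n, 'a) mpoly)"
  proof (induction b)
    case (Suc b)
    have "single m (Suc b) = single m 1 + single m b"
      by (simp flip: single_add)
    with Suc show ?case by (simp add: Var_def mon_add)
  qed simp
  then have "ideal {Var m ^ b} = (ideal (mon ` {single m b}) :: ('n, 'a) mpoly set)" by simp
  also have "\<dots> = mon_space {r + s | r s. s \<in> {single m b}}" by (rule ideal_mon)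
  also have "{r + s | r s. s \<in> {single m b}} = {s. b \<le> lookup s m}"
  proof (intro equalityI subsetI)
    fix u assume "u \<in> {s. b \<le> lookup s m}"
    then have "u = (u - single m b) + single m b"
      by (intro pp_diff_add[symmetric]) (auto simp: lookup_single when_def)
    then show "u \<in> {r + s | r s. s \<in> {single m b}}" by auto
  qed (auto simp: lookup_add)
  finally show ?thesis .
qed

lemma up_closed_sum_ge: "up_closed {s :: 'n pp. c \<le> (\<Sum>k\<in>A. lookup s k)}"
  and up_closed_lookup_ge: "up_closed {s :: 'n pp. c \<le> lookup s m}"
  unfolding up_closed_def by (auto simp: lookup_add sum.distrib)

lemma ideal_Vars:
  "ideal (Var ` A) = (mon_space {s. 1 \<le> (\<Sum>k\<in>A. lookup s k)} :: ('n::finite, 'a::comm_ring_1) mpoly set)"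
proof -
  have "ideal (Var ` A) = (ideal (mon ` (\<lambda>k. single k 1) ` A) :: ('n, 'a) mpoly set)"
    by (simp add: image_image Var_def)
  also have "\<dots> = mon_space {r + s | r s. s \<in> (\<lambda>k. single k 1) ` A}" by (rule ideal_mon)
  also have "{r + s | r s. s \<in> (\<lambda>k. single k 1) ` A} = {s :: 'n pp. 1 \<le> (\<Sum>k\<in>A. lookup s k)}"
  proof (intro equalityI subsetI)
    fix u :: "'n pp" assume "u \<in> {s. 1 \<le> (\<Sum>k\<in>A. lookup s k)}"
    then obtain k where k: "k \<in> A" "lookup u k > 0"
      by (metis (mono_tags, lifting) gr0I mem_Collect_eq not_one_le_zero sum.neutral)
    then have "u = (u - single k 1) + single k 1"
      by (intro pp_diff_add[symmetric]) (auto simp: lookup_single when_def)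
    with k show "u \<in> {r + s | r s. s \<in> (\<lambda>k. single k 1) ` A}" by auto
  qed (auto simp: lookup_add sum.distrib sum_lookup_single)
  finally show ?thesis .
qed

lemma ideal_power_Vars:
  "ideal_power (ideal (Var ` A)) c = (mon_space {s. c \<le> (\<Sum>k\<in>A. lookup s k)} :: ('n::finite, 'a::comm_ring_1) mpoly set)"
proof (induction c)
  case 0
  then show ?case by (simp add: mon_space_def)
next
  case (Suc c)
  have "{s + t | s t :: 'n pp. s \<in> {s. 1 \<le> (\<Sum>k\<in>A. lookup s k)} \<and> t \<in> {t. c \<le> (\<Sum>k\<in>A. lookup t k)}}
    = {s. Suc c \<le> (\<Sum>k\<in>A. lookup s k)}"
  proof (intro equalityI subsetI)
    fix u :: "'n pp" assume u: "u \<in> {s. Suc c \<le> (\<Sum>k\<in>A. lookup s k)}"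
    then have "(\<Sum>k\<in>A. lookup u k) > 0" by auto
    then obtain k where k: "k \<in> A" "lookup u k > 0"
      by (metis gr0I less_numeral_extra(3) sum.neutral)
    then have eq: "u = (u - single k 1) + single k 1"
      by (intro pp_diff_add[symmetric]) (auto simp: lookup_single when_def)
    then have "(\<Sum>i\<in>A. lookup u i) = (\<Sum>i\<in>A. lookup ((u - single k 1) + single k 1) i)" by (rule arg_cong)
    also have "\<dots> = (\<Sum>i\<in>A. lookup (u - single k 1) i) + 1"
      using k by (simp add: lookup_add sum.distrib sum_lookup_single)
    finally have "c \<le> (\<Sum>i\<in>A. lookup (u - single k 1) i)" using u by simp
    with k eq show "u \<in> {s + t | s t. s \<in> {s. 1 \<le> (\<Sum>k\<in>A. lookup s k)} \<and> t \<in> {t. c \<le> (\<Sum>k\<in>A. lookup t k)}}"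
      by (intro CollectI exI[of _ "single k 1"] exI[of _ "u - single k 1"]) (simp add: sum_lookup_single add.commute)
  qed (auto simp: lookup_add sum.distrib)
  moreover have "ideal_power (ideal (Var ` A)) (Suc c)
      = ideal_mult (ideal (Var ` A)) (mon_space {s. c \<le> (\<Sum>k\<in>A. lookup s k)} :: ('n, 'a) mpoly set)"
    by (simp only: ideal_power.simps Suc)
  ultimately show ?case
    by (simp only: ideal_Vars ideal_mult_mon_space[OF up_closed_sum_ge up_closed_sum_ge])
qed

text \<open>As x_1 is one of x_1, ..., x_j, the j-th summand is spanned by the power products whose
  exponent at x_1 is at least b_j and whose degree in x_1, ..., x_j is at least b_j + c_j; the
  latter number is \<open>pp_deg t\<close> for every j.\<close>

lemma gin_pps_ideal:
  fixes t :: "'n::{finite,linorder} pp"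
  shows "(\<Sum>j\<in>UNIV. ideal_mult (ideal {Var (Min UNIV) ^ (\<Sum>k<j. lookup t k)})
      (ideal_power (ideal (Var ` {..j})) (\<Sum>k | j \<le> k. lookup t k)))
    = (mon_space (gin_pps t) :: ('n, 'a::comm_ring_1) mpoly set)"
proof -
  have "{s + u | s u. s \<in> {s. b \<le> lookup s (Min UNIV)} \<and> u \<in> {s. c \<le> (\<Sum>k\<le>j. lookup s k)}}
     = {s :: 'n pp. b \<le> lookup s (Min UNIV) \<and> b + c \<le> (\<Sum>k\<le>j. lookup s k)}" (is "?L = ?R") for b c and j :: 'n
  proof (intro equalityI subsetI)
    fix x assume "x \<in> ?L"
    then obtain s u where "x = s + u" "b \<le> lookup s (Min UNIV)" "c \<le> (\<Sum>k\<le>j. lookup u k)" by auto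
    moreover have "lookup s (Min UNIV) \<le> (\<Sum>k\<le>j. lookup s k)"
      by (intro member_le_sum[of _ _ "lookup s"]) auto
    ultimately show "x \<in> ?R" by (auto simp: lookup_add sum.distrib)
  next
    fix x assume x: "x \<in> ?R"
    let ?s = "single (Min UNIV) b"
    have eq: "x = (x - ?s) + ?s"
      using x by (intro pp_diff_add[symmetric]) (auto simp: lookup_single when_def)
    then have "(\<Sum>k\<le>j. lookup x k) = (\<Sum>k\<le>j. lookup ((x - ?s) + ?s) k)" by (rule arg_cong)
    also have "\<dots> = (\<Sum>k\<le>j. lookup (x - ?s) k) + b"
      by (simp add: lookup_add sum.distrib sum_lookup_single)
    finally have "c \<le> (\<Sum>k\<le>j. lookup (x - ?s) k)" using x by simp
    with eq show "x \<in> ?L"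
      by (intro CollectI exI[of _ ?s] exI[of _ "x - ?s"]) (simp add: add.commute)
  qed
  then show ?thesis
    by (simp add: ideal_Var_power ideal_power_Vars
        ideal_mult_mon_space[OF up_closed_lookup_ge up_closed_sum_ge] sum_mon_space flip: pp_deg_split)
      (auto simp: gin_pps_def intro!: arg_cong[where f = mon_space])
qed

section \<open>Counting power products by the index where the partial sums reach d\<close>

lemma pivot_exists:
  fixes s :: "'n::{finite,linorder} pp"
  assumes "0 < d" "d \<le> (\<Sum>k\<le>j. lookup s k)"
  obtains p where "p \<le> j" "(\<Sum>k<p. lookup s k) < d" "d \<le> (\<Sum>k\<le>p. lookup s k)"
proof -
  let ?X = "{p. d \<le> (\<Sum>k\<le>p. lookup s k)}"
  define p where "p = Min ?X"
  have p: "d \<le> (\<Sum>k\<le>p. lookup s k)"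
    using Min_in[of ?X] assms(2) by (auto simp: p_def)
  have "p \<le> j" using assms(2) by (simp add: p_def)
  moreover have "(\<Sum>k<p. lookup s k) < d"
  \<comment> \<open>A predecessor of \<open>p\<close> exists unless \<open>p\<close> is the first
    index, where the empty sum is below \<open>d\<close> because \<open>0 < d\<close>.\<close>
  proof (cases "{..<p} = {}")
    case False
    define q where "q = Max {..<p}"
    have "q < p" using Max_in[OF _ False] by (simp add: q_def)
    moreover have "k \<le> q" if "k < p" for k
      using that by (simp add: q_def)
    ultimately have "{..<p} = {..q}" by auto
    moreover have "q \<notin> ?X"
      using Min_le[of ?X q] \<open>q < p\<close> by (auto simp: p_def simp del: Min_le)
    ultimately show ?thesis by simp
  qed (simp add: assms)
  ultimately show ?thesis using that p by blast
qed

lemma pivot_unique: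
  fixes s :: "'n::{finite,linorder} pp"
  assumes "(\<Sum>k<p. lookup s k) < d" "d \<le> (\<Sum>k\<le>p. lookup s k)"
    and "(\<Sum>k<q. lookup s k) < d" "d \<le> (\<Sum>k\<le>q. lookup s k)"
  shows "p = q"
proof -
  have "\<not> x < y" if "(\<Sum>k<y. lookup s k) < d" "d \<le> (\<Sum>k\<le>x. lookup s k)" for x y
  proof
    assume "x < y"
    then have "(\<Sum>k\<le>x. lookup s k) \<le> (\<Sum>k<y. lookup s k)"
      by (intro sum_mono2) auto
    with that show False by simp
  qed
  with assms show ?thesis by (meson linorder_neqE)
qed

text \<open>Replacing the factor \<open>x\<^sub>1\<^bsup>a\<^sub>1\<^esup> \<dots> x\<^bsub>j-1\<^esub>\<^bsup>a\<^bsub>j-1\<^esub>\<^esup>\<close> by the power of \<open>x\<^sub>1\<close> of the same degree, where \<open>j\<close> is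
  the index of the \<open>d\<close>-th smallest variable of the power product, is injective because it
  preserves \<open>j\<close>.\<close>
lemma card_stable_pps_le:
  fixes t :: "'n::{finite,linorder} pp"
  shows "card {s \<in> stable_pps t. pp_deg s = e} \<le> card {s \<in> gin_pps t. pp_deg s = e}"
proof (cases "t = 0")
  case True
  \<comment> \<open>For \<open>d = 0\<close> no pivot exists, but both sets consist of all power
    products.\<close>
  then show ?thesis by (simp add: stable_pps_def gin_pps_def)
next
  case False
  define d where "d = pp_deg t"
  have "d > 0" using False by (simp add: d_def pp_deg_eq_0_iff zero_less_iff_neq_zero)
  define pivot where "pivot s p \<longleftrightarrow> (\<Sum>k<p. lookup s k) < d \<and> d \<le> (\<Sum>k\<le>p. lookup s k)" for s :: "'n pp" and p
  define \<beta> where "\<beta> p = single (Min UNIV :: 'n) (\<Sum>k<p. lookup t k)" for p :: 'n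
  have "\<exists>p s'. pivot s p \<and> s = s' + head p t" if s: "s \<in> stable_pps t" for s
  proof -
    from s obtain j where j: "\<forall>k<j. lookup t k \<le> lookup s k" "d \<le> (\<Sum>k\<le>j. lookup s k)"
      by (auto simp: stable_pps_def d_def)
    \<comment> \<open>The pivot is at most \<open>j\<close>, so the conditions at the indices below
      \<open>j\<close> make \<open>head p t\<close> a divisor of \<open>s\<close>.\<close>
    then obtain p where p: "p \<le> j" "pivot s p"
      using pivot_exists[of d s j] \<open>d > 0\<close> unfolding pivot_def by blast
    have "s = (s - head p t) + head p t"
      using j(1) p(1) by (intro pp_diff_add[symmetric]) (simp add: lookup_head)
    with p show ?thesis by blast
  qed
  then obtain P R where P: "\<And>s. s \<in> stable_pps t \<Longrightarrow> pivot s (P s)"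
    and R: "\<And>s. s \<in> stable_pps t \<Longrightarrow> s = R s + head (P s) t"
    by metis
  define \<phi> where "\<phi> s = R s + \<beta> (P s)" for s :: "'n pp"
  have sum_\<phi>: "(\<Sum>k<P s. lookup (\<phi> s) k) = (\<Sum>k<P s. lookup s k)"
    "(\<Sum>k\<le>P s. lookup (\<phi> s) k) = (\<Sum>k\<le>P s. lookup s k)"
    "pp_deg (\<phi> s) = pp_deg s" if s: "s \<in> stable_pps t" for s
  proof -
    have "(\<Sum>k\<in>A. lookup (\<phi> s) k) = (\<Sum>k\<in>A. lookup s k)" if A: "{..<P s} \<subseteq> A" for A
    proof -
      \<comment> \<open>Both factors have the same degree, and x_1 lies in \<open>A\<close> unless
        the pivot is the first index, where both factors are 1.\<close>
      have "Min UNIV \<in> A \<or> {..<P s} = {}"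
        using A by (metis Min_UNIV_le equals0I lessThan_iff order_le_less_trans subsetD)
      then have "(\<Sum>k\<in>A. lookup (\<beta> (P s)) k) = (\<Sum>k<P s. lookup t k)"
        by (auto simp: \<beta>_def sum_lookup_single)
      also have "\<dots> = (\<Sum>k\<in>A. lookup (head (P s) t) k)"
        using A by (simp add: sum_head Int_absorb1)
      finally have "(\<Sum>k\<in>A. lookup (R s + \<beta> (P s)) k) = (\<Sum>k\<in>A. lookup (R s + head (P s) t) k)"
        by (simp add: lookup_add sum.distrib)
      then show ?thesis
        using R[OF s] by (simp add: \<phi>_def)
    qed
    from this[of "{..<P s}"] this[of "{..P s}"] this[of UNIV]
    show "(\<Sum>k<P s. lookup (\<phi> s) k) = (\<Sum>k<P s. lookup s k)"
      "(\<Sum>k\<le>P s. lookup (\<phi> s) k) = (\<Sum>k\<le>P s. lookup s k)" "pp_deg (\<phi> s) = pp_deg s"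
      by (auto simp: pp_deg_def subset_iff less_imp_le)
  qed
  have pivot_\<phi>: "pivot (\<phi> s) (P s)" if "s \<in> stable_pps t" for s
    using P[OF that] sum_\<phi>[OF that] by (simp add: pivot_def)
  show ?thesis
  proof (rule card_inj_on_le[of \<phi>])
    show "inj_on \<phi> {s \<in> stable_pps t. pp_deg s = e}"
    proof (rule inj_onI)
      fix s s' assume s: "s \<in> {s \<in> stable_pps t. pp_deg s = e}" and s': "s' \<in> {s \<in> stable_pps t. pp_deg s = e}"
        and eq: "\<phi> s = \<phi> s'"
      have "P s = P s'"
        using pivot_\<phi>[of s] pivot_\<phi>[of s'] s s' eq pivot_unique unfolding pivot_def by auto
      with eq have "R s = R s'" by (simp add: \<phi>_def)
      with \<open>P s = P s'\<close> R[of s] R[of s'] s s' show "s = s'" by simp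
    qed
    show "\<phi> ` {s \<in> stable_pps t. pp_deg s = e} \<subseteq> {s \<in> gin_pps t. pp_deg s = e}"
    proof safe
      fix s assume s: "s \<in> stable_pps t"
      show "\<phi> s \<in> gin_pps t"
        unfolding gin_pps_def using pivot_\<phi>[OF s]
        by (auto simp: \<phi>_def \<beta>_def lookup_add pivot_def d_def intro!: exI[of _ "P s"])
    qed (simp add: sum_\<phi>)
    show "finite {s \<in> gin_pps t. pp_deg s = e}"
      by (rule finite_subset[OF _ finite_pp_deg[of e]]) auto
  qed
qed


section \<open>Leading power products\<close>

text \<open>A relational form of \<open>leading_pp\<close>, which separates existence from
  uniqueness; the zero polynomial has no lead.\<close>

definition is_lead :: "'n pp rel \<Rightarrow> ('n, 'a::zero) mpoly \<Rightarrow> 'n pp \<Rightarrow> bool"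
  where "is_lead \<tau> p u \<longleftrightarrow> lookup p u \<noteq> 0 \<and> (\<forall>s\<in>keys p. (s, u) \<in> \<tau>)"

lemma term_ordering_refl: "term_ordering \<tau> \<Longrightarrow> (s, s) \<in> \<tau>"
  and term_ordering_trans: "term_ordering \<tau> \<Longrightarrow> (s, u) \<in> \<tau> \<Longrightarrow> (u, v) \<in> \<tau> \<Longrightarrow> (s, v) \<in> \<tau>"
  and term_ordering_antisym: "term_ordering \<tau> \<Longrightarrow> (s, u) \<in> \<tau> \<Longrightarrow> (u, s) \<in> \<tau> \<Longrightarrow> s = u"
  and term_ordering_total: "term_ordering \<tau> \<Longrightarrow> (s, u) \<in> \<tau> \<or> (u, s) \<in> \<tau>"
  and term_ordering_add: "term_ordering \<tau> \<Longrightarrow> (s, u) \<in> \<tau> \<Longrightarrow> (s + w, u + w) \<in> \<tau>"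
  and term_ordering_single: "term_ordering \<tau> \<Longrightarrow> i \<le> j \<Longrightarrow> (single j 1, single i 1) \<in> \<tau>"
  unfolding term_ordering_def linear_order_on_def partial_order_on_def preorder_on_def
    refl_on_def trans_def antisym_def total_on_def
  by (metis UNIV_I le_neq_trans)+

lemma term_ordering_max:
  assumes "term_ordering \<tau>" "finite A" "A \<noteq> {}"
  obtains u where "u \<in> A" "\<And>s. s \<in> A \<Longrightarrow> (s, u) \<in> \<tau>"
proof -
  have "\<exists>u\<in>A. \<forall>s\<in>A. (s, u) \<in> \<tau>"
    using assms(2,3)
  proof (induction A rule: finite_ne_induct)
    case (singleton x)
    then show ?case using term_ordering_refl[OF assms(1)] by simp
  next
    case (insert x A)
    then obtain u where u: "u \<in> A" "\<forall>s\<in>A. (s, u) \<in> \<tau>" by auto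
    show ?case
    proof (cases "(x, u) \<in> \<tau>")
      case False
      then have "(u, x) \<in> \<tau>" using term_ordering_total[OF assms(1)] by blast
      then show ?thesis
        using u term_ordering_refl[OF assms(1)] term_ordering_trans[OF assms(1)] by blast
    qed (use u in auto)
  qed
  then show ?thesis using that by blast
qed

lemma is_lead_exists:
  assumes "term_ordering \<tau>" "p \<noteq> 0"
  obtains u where "is_lead \<tau> p u"
  using term_ordering_max[OF assms(1), of "keys p"] assms(2) that
  by (metis finite_keys in_keys_iff is_lead_def keys_eq_empty)

lemma is_lead_unique: "term_ordering \<tau> \<Longrightarrow> is_lead \<tau> p u \<Longrightarrow> is_lead \<tau> p v \<Longrightarrow> u = v"
  unfolding is_lead_def using term_ordering_antisym by (metis in_keys_iff)

lemma leading_pp_eqI: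
  assumes "term_ordering \<tau>" "is_lead \<tau> p u"
  shows "leading_pp \<tau> p = u"
  unfolding leading_pp_def
  by (rule the_equality)
    (use assms is_lead_unique[OF assms(1)] in \<open>auto simp: is_lead_def in_keys_iff\<close>)

lemma is_lead_mon: "term_ordering \<tau> \<Longrightarrow> is_lead \<tau> (mon u :: ('n::{finite,linorder}, 'a::comm_ring_1) mpoly) u"
  by (simp add: is_lead_def mon_def term_ordering_refl)

text \<open>If \<open>s\<close> is at most \<open>u\<close> and \<open>s'\<close> at most
  \<open>v\<close>, then \<open>s + s' = u + v\<close> only for \<open>s = u\<close> and
  \<open>s' = v\<close>. So the coefficient at \<open>u + v\<close> is a product of two nonzero
  field elements.\<close>

lemma is_lead_mult:
  fixes p q :: "('n::{finite,linorder}, 'a::field) mpoly"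
  assumes \<tau>: "term_ordering \<tau>" and p: "is_lead \<tau> p u" and q: "is_lead \<tau> q v"
  shows "is_lead \<tau> (p * q) (u + v)"
proof -
  have le: "(s + s', u + v) \<in> \<tau>" and eq: "s + s' = u + v \<Longrightarrow> s = u \<and> s' = v"
    if "(s, u) \<in> \<tau>" "(s', v) \<in> \<tau>" for s s'
  proof -
    have 1: "(s + s', u + s') \<in> \<tau>"
      using term_ordering_add[OF \<tau> that(1)] .
    have 2: "(u + s', u + v) \<in> \<tau>"
      using term_ordering_add[OF \<tau> that(2), of u] by (simp add: add.commute)
    show "(s + s', u + v) \<in> \<tau>"
      using term_ordering_trans[OF \<tau> 1 2] .
    assume "s + s' = u + v"
    with 1 2 have "u + s' = u + v"
      using term_ordering_antisym[OF \<tau>] by metis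
    with \<open>s + s' = u + v\<close> show "s = u \<and> s' = v"
      by (metis add_left_cancel add_right_cancel)
  qed
  define p' where "p' = p - single u (lookup p u)"
  define q' where "q' = q - single v (lookup q v)"
  have keys_p': "keys p' \<subseteq> keys p - {u}" and keys_q': "keys q' \<subseteq> keys q - {v}"
    by (auto simp: p'_def q'_def in_keys_iff lookup_minus lookup_single when_def split: if_splits)
  have "p * q = single (u + v) (lookup p u * lookup q v) + single u (lookup p u) * q' + p' * q"
    unfolding p'_def q'_def by (simp add: algebra_simps mult_single)
  moreover have "lookup (single u (lookup p u) * q') (u + v) = 0"
    using keys_mult[of "single u (lookup p u)" q'] keys_q'
    by (fastforce simp: not_in_keys_iff_lookup_eq_zero[symmetric] split: if_splits)
  moreover have "lookup (p' * q) (u + v) = 0"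
  proof (rule ccontr)
    assume "lookup (p' * q) (u + v) \<noteq> 0"
    then obtain s s' where "u + v = s + s'" "s \<in> keys p'" "s' \<in> keys q"
      using keys_mult[of p' q] by (auto simp: in_keys_iff)
    with eq[of s s'] keys_p' p q show False
      by (auto simp: is_lead_def)
  qed
  ultimately have "lookup (p * q) (u + v) = lookup p u * lookup q v"
    by (simp add: lookup_add)
  moreover have "(w, u + v) \<in> \<tau>" if "w \<in> keys (p * q)" for w
    using keys_mult[of p q] that le p q by (auto simp: is_lead_def)
  ultimately show ?thesis
    using p q by (simp add: is_lead_def)
qed

lemma is_lead_prod:
  fixes p :: "'i \<Rightarrow> ('n::{finite,linorder}, 'a::field) mpoly"
  assumes "term_ordering \<tau>" "\<And>i. i \<in> A \<Longrightarrow> is_lead \<tau> (p i) (u i)"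
  shows "is_lead \<tau> (\<Prod>i\<in>A. p i) (\<Sum>i\<in>A. u i)"
  using assms(2)
proof (induction A rule: infinite_finite_induct)
  case (insert x A)
  then show ?case by (simp add: is_lead_mult[OF assms(1)])
qed (use is_lead_mon[OF assms(1), of 0] in simp_all)

text \<open>The leads of \<open>S\<close> already form an up closed set, so passing to the generated
  ideal adds no power products.\<close>

lemma initial_ideal_eqI:
  fixes S :: "('n::{finite,linorder}, 'a::field) mpoly set"
  assumes \<tau>: "term_ordering \<tau>" and M: "up_closed M"
    and sub: "\<And>p u. p \<in> S \<Longrightarrow> is_lead \<tau> p u \<Longrightarrow> u \<in> M"
    and sup: "\<And>u. u \<in> M \<Longrightarrow> \<exists>p\<in>S. is_lead \<tau> p u"
  shows "initial_ideal \<tau> S = mon_space M"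
proof -
  have "{mon (leading_pp \<tau> p) | p. p \<in> S \<and> p \<noteq> 0} = (mon ` M :: ('n, 'a) mpoly set)"
  proof (intro equalityI subsetI)
    fix x :: "('n, 'a) mpoly" assume "x \<in> {mon (leading_pp \<tau> p) | p. p \<in> S \<and> p \<noteq> 0}"
    then obtain p where "x = mon (leading_pp \<tau> p)" "p \<in> S" "p \<noteq> 0" by auto
    then show "x \<in> mon ` M"
      using is_lead_exists[OF \<tau>, of p] leading_pp_eqI[OF \<tau>, of p] sub by (metis image_eqI)
  next
    fix x :: "('n, 'a) mpoly" assume "x \<in> mon ` M"
    then obtain u p where u: "x = mon u" "p \<in> S" "is_lead \<tau> p u" using sup by blast
    moreover from u(3) have "p \<noteq> 0" by (auto simp: is_lead_def)
    ultimately show "x \<in> {mon (leading_pp \<tau> p) | p. p \<in> S \<and> p \<noteq> 0}"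
      using leading_pp_eqI[OF \<tau>, of p u] by blast
  qed
  then show ?thesis
    unfolding initial_ideal_def using ideal_mon_up_closed[OF M] by simp
qed

section \<open>Leading power products and dimension\<close>

lemma vector_space_const:
  "vector_space (\<lambda>c p. const c * p :: ('n, 'a::field) mpoly)"
  by unfold_locales
    (simp_all add: algebra_simps const_add const_mult)

text \<open>Polynomials with distinct leads are linearly independent, so a spanning set has at least
  as many elements as there are leads.\<close>

lemma card_leads_le:
  fixes B :: "('n::{finite,linorder}, 'a::field) mpoly set"
  assumes \<tau>: "term_ordering \<tau>" and B: "finite B"
  shows "finite {u. \<exists>p\<in>K_span B. is_lead \<tau> p u}"
    and "card {u. \<exists>p\<in>K_span B. is_lead \<tau> p u} \<le> card B"
proof -
  interpret V: vector_space "\<lambda>c p. const c * p :: ('n, 'a) mpoly"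
    by (rule vector_space_const)
  let ?U = "{u. \<exists>p\<in>K_span B. is_lead \<tau> p u}"
  define v where "v u = (SOME p. p \<in> K_span B \<and> is_lead \<tau> p u)" for u
  have "v u \<in> K_span B \<and> is_lead \<tau> (v u) u" if "u \<in> ?U" for u
  proof -
    from that have "\<exists>p. p \<in> K_span B \<and> is_lead \<tau> p u" by (simp add: Bex_def)
    then show ?thesis unfolding v_def by (rule someI_ex)
  qed
  then have v: "\<And>u. u \<in> ?U \<Longrightarrow> v u \<in> K_span B" "\<And>u. u \<in> ?U \<Longrightarrow> is_lead \<tau> (v u) u"
    by simp_all
  have inj: "inj_on v ?U"
  proof (rule inj_onI)
    fix s u assume "s \<in> ?U" "u \<in> ?U" "v s = v u"
    then show "s = u"
      using v(2)[of s] v(2)[of u] is_lead_unique[OF \<tau>] by simp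
  qed
  have "V.independent (v ` ?U)"
    unfolding V.independent_explicit_finite_subsets
  proof (intro allI impI ballI)
    fix S c w assume S: "S \<subseteq> v ` ?U" "finite S" "(\<Sum>x\<in>S. const (c x) * x) = 0" "w \<in> S"
    obtain W where W: "W \<subseteq> ?U" "S = v ` W"
      using S(1) by (auto simp: subset_image_iff)
    have lead: "is_lead \<tau> (v s) s" if "s \<in> W" for s
      using v(2)[of s] that W(1) by blast
    have injW: "inj_on v W" using inj W(1) by (rule inj_on_subset)
    with W S(2) have "finite W" by (simp add: finite_image_iff)
    show "c w = 0"
    proof (rule ccontr)
      assume "c w \<noteq> 0"
      with S(4) W(2) have ne: "{u \<in> W. c (v u) \<noteq> 0} \<noteq> {}" by auto
      have fin: "finite {u \<in> W. c (v u) \<noteq> 0}" using \<open>finite W\<close> by simp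
      \<comment> \<open>At the largest lead \<open>u\<close> that carries a nonzero coefficient, no
        other summand of the relation contributes.\<close>
      obtain u where u': "u \<in> {u \<in> W. c (v u) \<noteq> 0}" and max': "\<And>s. s \<in> {u \<in> W. c (v u) \<noteq> 0} \<Longrightarrow> (s, u) \<in> \<tau>"
        using term_ordering_max[OF \<tau> fin ne] by blast
      from u' have u: "u \<in> W" "c (v u) \<noteq> 0" by simp_all
      from max' have max: "(s, u) \<in> \<tau>" if "s \<in> W" "c (v s) \<noteq> 0" for s
        using that by simp
      have zero: "c (v s) * lookup (v s) u = 0" if "s \<in> W - {u}" for s
      proof (rule ccontr)
        assume nz: "c (v s) * lookup (v s) u \<noteq> 0"
        then have "(s, u) \<in> \<tau>" using max that by auto
        moreover have "(u, s) \<in> \<tau>"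
          using nz lead[of s] that by (auto simp: is_lead_def in_keys_iff)
        ultimately show False
          using term_ordering_antisym[OF \<tau>] that by blast
      qed
      have rest: "(\<Sum>s\<in>W - {u}. c (v s) * lookup (v s) u) = 0"
        by (intro sum.neutral ballI zero)
      have "0 = lookup (\<Sum>x\<in>S. const (c x) * x) u" using S(3) by simp
      also have "\<dots> = (\<Sum>s\<in>W. c (v s) * lookup (v s) u)"
        unfolding W(2) by (simp add: sum.reindex[OF injW] lookup_sum lookup_const_times)
      also have "\<dots> = c (v u) * lookup (v u) u"
        by (simp add: sum.remove[OF \<open>finite W\<close> u(1)] rest)
      finally show False
        using u lead[of u] by (auto simp: is_lead_def)
    qed
  qed
  moreover have "v ` ?U \<subseteq> V.span B"
    using v(1) by (auto simp: K_span_def)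
  ultimately have "finite (v ` ?U) \<and> card (v ` ?U) \<le> card B"
    by (intro V.independent_span_bound[OF B])
  with inj show "finite ?U" "card ?U \<le> card B"
    by (auto simp: finite_image_iff card_image)
qed


section \<open>DegRevLex\<close>

lemma drl_iff:
  fixes s t :: "'n::{finite,linorder} pp"
  assumes "pp_deg s = pp_deg t"
  shows "(s, t) \<in> drl \<longleftrightarrow> s = t \<or> (\<exists>k. lookup t k < lookup s k \<and> (\<forall>i>k. lookup s i = lookup t i))"
  using assms by (simp add: drl_def)

lemma term_ordering_drl: "term_ordering (drl :: 'n::{finite,linorder} pp rel)"
  unfolding term_ordering_def
proof (intro conjI allI impI)
  show "linear_order (drl :: 'n pp rel)"
    unfolding linear_order_on_def partial_order_on_def preorder_on_def
  proof (intro conjI)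
    show "refl (drl :: 'n pp rel)" by (auto simp: refl_on_def drl_def)
    show "trans (drl :: 'n pp rel)"
    proof (rule transI)
      fix s t u :: "'n pp" assume st: "(s, t) \<in> drl" and tu: "(t, u) \<in> drl"
      show "(s, u) \<in> drl"
      proof (cases "pp_deg s = pp_deg t \<and> pp_deg t = pp_deg u")
        case False
        then have "pp_deg s < pp_deg u" using st tu by (auto simp: drl_def)
        then show ?thesis by (simp add: drl_def)
      next
        case True
        show ?thesis
        proof (cases "s = t \<or> t = u")
          case False
          with True st tu obtain k l where
            k: "lookup t k < lookup s k" "\<forall>i>k. lookup s i = lookup t i" and
            l: "lookup u l < lookup t l" "\<forall>i>l. lookup t i = lookup u i"
            using drl_iff[of s t] drl_iff[of t u] by blast
          \<comment> \<open>The later of the two positions is the last one at which \<open>s\<close>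
            and \<open>u\<close> differ.\<close>
          have "lookup u (max k l) < lookup s (max k l)" "\<forall>i>max k l. lookup s i = lookup u i"
            using k l by (cases k l rule: linorder_cases; simp add: max_def)+
          with True show ?thesis using drl_iff[of s u] by (auto simp: max_def)
        qed (use st tu in auto)
      qed
    qed
    show "antisym (drl :: 'n pp rel)"
    proof (rule antisymI)
      fix s t :: "'n pp" assume st: "(s, t) \<in> drl" and ts: "(t, s) \<in> drl"
      show "s = t"
      proof (rule ccontr)
        assume "s \<noteq> t"
        have deg: "pp_deg s = pp_deg t" using st ts by (auto simp: drl_def)
        from st \<open>s \<noteq> t\<close> obtain k where
          k: "lookup t k < lookup s k" "\<forall>i>k. lookup s i = lookup t i"
          unfolding drl_iff[OF deg] by blast
        from ts \<open>s \<noteq> t\<close> obtain l where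
          l: "lookup s l < lookup t l" "\<forall>i>l. lookup t i = lookup s i"
          unfolding drl_iff[OF deg[symmetric]] by blast
        with k show False by (metis linorder_less_linear order_less_asym)
      qed
    qed
    show "total (drl :: 'n pp rel)"
    proof (rule total_onI)
      fix s t :: "'n pp" assume "s \<noteq> t"
      let ?D = "{k. lookup s k \<noteq> lookup t k}"
      have ne: "?D \<noteq> {}"
        using \<open>s \<noteq> t\<close> by (auto intro: poly_mapping_eqI)
      define k where "k = Max ?D"
      have "lookup s k \<noteq> lookup t k"
        using Max_in[OF _ ne] by (simp add: k_def)
      moreover have "lookup s i = lookup t i" if "i > k" for i
      proof (rule ccontr)
        assume "lookup s i \<noteq> lookup t i"
        then have "i \<le> k" unfolding k_def by (intro Max_ge) auto
        with that show False by simp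
      qed
      ultimately show "(s, t) \<in> drl \<or> (t, s) \<in> drl"
        unfolding drl_def mem_Collect_eq case_prod_conv
        by (metis linorder_neqE_nat)
    qed
  qed simp_all
next
  fix t :: "'n pp" show "(0, t) \<in> drl"
    by (cases "t = 0") (auto simp: drl_def pp_deg_eq_0_iff zero_less_iff_neq_zero)
next
  fix s t u :: "'n pp" assume "(s, t) \<in> drl"
  then show "(s + u, t + u) \<in> drl" by (auto simp: drl_def pp_deg_add lookup_add)
next
  fix s t :: "'n pp" assume "pp_deg s < pp_deg t"
  then show "(s, t) \<in> drl" by (simp add: drl_def)
next
  fix i j :: 'n assume "i < j"
  then show "(single j 1, single i 1) \<in> drl"
    by (auto simp: drl_def lookup_single when_def intro!: exI[of _ j])
qed

text \<open>Every term other than \<open>u\<close> contains a variable beyond \<open>j\<close>. Its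
  last variable has exponent zero in \<open>u\<close>, so DegRevLex puts it below \<open>u\<close>.
  This is the property that distinguishes DegRevLex here.\<close>

lemma is_lead_drlI:
  fixes v :: "('n::{finite,linorder}, 'a::field) mpoly"
  assumes deg: "v \<in> homogeneous_component (pp_deg u)"
    and u: "\<And>k. j < k \<Longrightarrow> lookup u k = 0"
    and v: "v - mon u \<in> mon_space {s. \<exists>k>j. lookup s k \<noteq> 0}"
  shows "is_lead drl v u"
  unfolding is_lead_def
proof (intro conjI ballI)
  have keys: "lookup (v - mon u) s = 0" if "\<forall>k>j. lookup s k = 0" for s
    using v that by (force simp: mon_space_def in_keys_iff)
  from keys[of u] u show "lookup v u \<noteq> 0"
    by (simp add: lookup_minus mon_def)
  fix s assume s: "s \<in> keys v"
  have deg: "pp_deg s = pp_deg u"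
    using deg s by (auto simp: homogeneous_component_def)
  show "(s, u) \<in> drl"
  proof (cases "s = u")
    case False
    with s have "lookup (v - mon u) s \<noteq> 0"
      by (simp add: lookup_minus mon_def lookup_single in_keys_iff)
    then obtain k where k: "k > j" "lookup s k \<noteq> 0" using keys by blast
    define l where "l = Max (keys s)"
    have "l \<in> keys s" unfolding l_def using k by (intro Max_in) (auto simp: in_keys_iff)
    moreover have "k \<le> l" unfolding l_def using k by (intro Max_ge) (auto simp: in_keys_iff)
    moreover have "lookup s i = 0" if "i > l" for i
      using that unfolding l_def by (metis Max_ge finite_keys in_keys_iff not_less)
    ultimately show ?thesis
      using k u unfolding drl_iff[OF deg]
      by (intro disjI2 exI[of _ l]) (auto simp: in_keys_iff)
  qed (simp add: drl_def)
qed


section \<open>Distractions\<close>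

definition dist_mon :: "('n::finite \<Rightarrow> nat \<Rightarrow> ('n, 'a::comm_ring_1) mpoly) \<Rightarrow> 'n pp \<Rightarrow> ('n, 'a) mpoly"
  where "dist_mon h s = (\<Prod>i\<in>UNIV. \<Prod>j=1..lookup s i. h i j)"

text \<open>The forms left in each row after the distraction of \<open>l\<close> has used up the
  first \<open>lookup l i\<close> of them.\<close>

definition shift :: "'n pp \<Rightarrow> ('n \<Rightarrow> nat \<Rightarrow> 'b) \<Rightarrow> 'n \<Rightarrow> nat \<Rightarrow> 'b"
  where "shift l h i k = h i (lookup l i + k)"

lemma distraction_eq_lin_ext: "distraction h = lin_ext const (dist_mon h)"
  by (rule ext) (simp add: distraction_def lin_ext_def dist_mon_def)

lemma dist_mon_add: "dist_mon h (l + w) = dist_mon h l * dist_mon (shift l h) w"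
proof -
  have "(\<Prod>j=1..a + b. f j) = (\<Prod>j=1..a. f j) * (\<Prod>j=1..b. f (a + j))" for a b and f :: "nat \<Rightarrow> ('a, 'b) mpoly"
    by (induction b) (simp_all add: mult.assoc)
  then show ?thesis
    by (simp add: dist_mon_def shift_def lookup_add prod.distrib)
qed

lemma dist_mon_0 [simp]: "dist_mon h 0 = 1"
  by (simp add: dist_mon_def)

lemma dist_mon_add_single: "dist_mon h (w + single k 1) = h k (lookup w k + 1) * dist_mon h w"
proof -
  have "(\<Prod>j=1..lookup (single k 1) i. h' i j) = (if i = k then h' i 1 else 1)" for i and h' :: "'a \<Rightarrow> nat \<Rightarrow> ('a, 'b) mpoly"
    by (simp add: lookup_single when_def)
  then have "dist_mon h' (single k 1) = h' k 1" for h' :: "'a \<Rightarrow> nat \<Rightarrow> ('a, 'b) mpoly"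
    unfolding dist_mon_def by simp
  then show ?thesis
    by (simp add: dist_mon_add shift_def mult.commute)
qed

lemma distraction_mon_times:
  "distraction h (mon l * p) = dist_mon h l * distraction (shift l h) p"
  unfolding distraction_eq_lin_ext
  by (rule lin_ext_mon_times[of const "dist_mon h" l "dist_mon h l" "dist_mon (shift l h)", OF coeff_hom_const dist_mon_add])

lemma distraction_linear:
  shows distraction_mon: "distraction h (mon s) = dist_mon h s"
    and distraction_const_times: "distraction h (const a * p) = const a * distraction h p"
    and distraction_sum: "distraction h (sum f A) = (\<Sum>x\<in>A. distraction h (f x))"
  unfolding distraction_eq_lin_ext
  by (simp_all add: lin_ext_mon lin_ext_const_times lin_ext_sum coeff_hom_const)

text \<open>Multiplying the distraction of \<open>w\<close> by the next form
  \<open>h k (lookup w k + 1)\<close> gives the distraction of \<open>w + single k 1\<close>. The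
  coefficients \<beta> may therefore vary with the term \<open>w\<close>, and the result is still a
  distraction.\<close>

lemma distraction_step:
  fixes \<beta> :: "'n::finite pp \<Rightarrow> 'n \<Rightarrow> 'a::comm_ring_1" and p :: "('n, 'a) mpoly"
  obtains p' where "keys p' \<subseteq> {w + single k 1 | w k. w \<in> keys p \<and> k \<in> A}"
    and "distraction h p' = (\<Sum>w\<in>keys p. const (lookup p w) *
      ((\<Sum>k\<in>A. const (\<beta> w k) * h k (lookup w k + 1)) * dist_mon h w))"
proof -
  define p' where "p' = (\<Sum>w\<in>keys p. const (lookup p w) * (\<Sum>k\<in>A. const (\<beta> w k) * mon (w + single k 1)))"
  have "p' \<in> mon_space {w + single k 1 | w k. w \<in> keys p \<and> k \<in> A}"
    unfolding p'_def by (intro mon_space_sum mon_space_const_mult) auto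
  moreover have "distraction h p' = (\<Sum>w\<in>keys p. const (lookup p w) *
      ((\<Sum>k\<in>A. const (\<beta> w k) * h k (lookup w k + 1)) * dist_mon h w))"
    unfolding p'_def distraction_sum distraction_const_times distraction_mon dist_mon_add_single
    by (simp add: sum_distrib_right mult.assoc)
  ultimately show ?thesis using that by (simp add: mon_space_def)
qed

lemma homogeneous_component_eq: "homogeneous_component d = mon_space {s. pp_deg s = d}"
  by (auto simp: homogeneous_component_def mon_space_def)

lemma homogeneous_1: "1 \<in> homogeneous_component 0"
  by (simp add: homogeneous_component_def flip: mon_0)

lemma homogeneous_mult:
  "p \<in> homogeneous_component d \<Longrightarrow> q \<in> homogeneous_component e \<Longrightarrow> p * q \<in> homogeneous_component (d + e)"
  using keys_mult[of p q] by (fastforce simp: homogeneous_component_def pp_deg_add)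

lemma homogeneous_prod:
  assumes "\<And>i. i \<in> A \<Longrightarrow> f i \<in> homogeneous_component (d i)"
  shows "prod f A \<in> homogeneous_component (sum d A)"
  using assms
  by (induction A rule: infinite_finite_induct) (simp_all add: homogeneous_1 homogeneous_mult)

lemma homogeneous_dist_mon:
  assumes "\<And>i k. k \<ge> 1 \<Longrightarrow> h i k \<in> homogeneous_component 1"
  shows "dist_mon h s \<in> homogeneous_component (pp_deg s)"
proof -
  have "(\<Prod>j=1..lookup s i. h i j) \<in> homogeneous_component (lookup s i)" for i
    using homogeneous_prod[of "{1..lookup s i}" "h i" "\<lambda>_. 1"] assms by simp
  then show ?thesis
    unfolding dist_mon_def pp_deg_def by (intro homogeneous_prod)
qed

lemma homogeneous_distraction:
  assumes "\<And>i k. k \<ge> 1 \<Longrightarrow> h i k \<in> homogeneous_component 1" "p \<in> homogeneous_component d"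
  shows "distraction h p \<in> homogeneous_component d"
proof -
  have "const (lookup p t) * dist_mon h t \<in> homogeneous_component d" if "t \<in> keys p" for t
  proof -
    have "pp_deg t = d" using that assms(2) by (auto simp: homogeneous_component_def)
    then show ?thesis
      using homogeneous_dist_mon[of h t, OF assms(1)]
      unfolding homogeneous_component_eq by (simp add: mon_space_const_mult)
  qed
  then show ?thesis
    unfolding distraction_eq_lin_ext lin_ext_def homogeneous_component_eq by (intro mon_space_sum)
qed


section \<open>Distractions by generic linear forms\<close>

text \<open>The last condition says that for every choice \<open>c\<close> of columns the
  coefficients at x_1, ..., x_j of the first j forms make an invertible j by j matrix. For the last
  index j it expresses each variable exactly through the forms. With \<open>c\<close> arbitrary, the
  property passes to \<open>shift l h\<close>.\<close>

definition generic_forms :: "('n::{finite,linorder} \<Rightarrow> nat \<Rightarrow> ('n, 'a::comm_ring_1) mpoly) \<Rightarrow> bool"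
  where "generic_forms h \<longleftrightarrow>
    (\<forall>i. \<forall>k\<ge>1. h i k \<in> homogeneous_component 1) \<and>
    (\<forall>i. \<forall>k\<ge>1. lookup (h i k) (single (Min UNIV) 1) \<noteq> 0) \<and>
    (\<forall>c j i. (\<forall>k. c k \<ge> 1) \<longrightarrow> i \<le> j \<longrightarrow>
      (\<exists>\<beta>. keys ((\<Sum>k\<le>j. const (\<beta> k) * h k (c k)) - Var i) \<subseteq> {single r 1 | r. j < r}))"

lemma generic_formsD:
  assumes "generic_forms h"
  shows generic_forms_homogeneous: "k \<ge> 1 \<Longrightarrow> h i k \<in> homogeneous_component 1"
    and generic_forms_first: "k \<ge> 1 \<Longrightarrow> lookup (h i k) (single (Min UNIV) 1) \<noteq> 0"
    and generic_forms_span: "(\<And>k. c k \<ge> 1) \<Longrightarrow> i \<le> j \<Longrightarrow>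
      \<exists>\<beta>. keys ((\<Sum>k\<le>j. const (\<beta> k) * h k (c k)) - Var i) \<subseteq> {single r 1 | r. j < r}"
  using assms unfolding generic_forms_def by blast+

lemma generic_forms_shift: "generic_forms h \<Longrightarrow> generic_forms (shift l h)"
  unfolding generic_forms_def shift_def
  by (simp add: trans_le_add2)

lemma single_of_deg_1:
  assumes "pp_deg s = 1"
  obtains k where "s = single k 1"
proof -
  have "s \<noteq> 0" using assms by auto
  then obtain k where "lookup s k \<noteq> 0"
    by (metis lookup_zero poly_mapping_eqI)
  then have eq: "s = (s - single k 1) + single k 1"
    by (intro pp_diff_add[symmetric]) (auto simp: lookup_single when_def)
  then have "pp_deg s = pp_deg (s - single k 1) + 1"
    by (metis pp_deg_add pp_deg_single)
  with assms have "s - single k 1 = 0"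
    by (simp add: pp_deg_eq_0_iff)
  with eq show ?thesis using that by simp
qed

lemma is_lead_linear:
  assumes "term_ordering \<tau>" "p \<in> homogeneous_component 1" "lookup p (single (Min UNIV) 1) \<noteq> 0"
  shows "is_lead \<tau> p (single (Min UNIV) 1)"
  unfolding is_lead_def
proof (intro conjI ballI assms(3))
  fix s assume "s \<in> keys p"
  then have "pp_deg s = 1" using assms(2) by (simp add: homogeneous_component_def)
  then obtain k where "s = single k 1" by (rule single_of_deg_1)
  then show "(s, single (Min UNIV) 1) \<in> \<tau>"
    using term_ordering_single[OF assms(1)] by simp
qed

lemma sum_const_single: "finite A \<Longrightarrow> (\<Sum>i\<in>A. single m (f i)) = single m (\<Sum>i\<in>A. f i :: nat)"
  by (induction A rule: finite_induct) (simp_all add: single_add)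

text \<open>Each of the \<open>pp_deg s\<close> linear factors has lead x_1, the largest variable.
  This is how \<open>head j t\<close> turns into a power of x_1.\<close>

lemma is_lead_dist_mon:
  fixes h :: "'n::{finite,linorder} \<Rightarrow> nat \<Rightarrow> ('n, 'a::field) mpoly"
  assumes \<tau>: "term_ordering \<tau>" and h: "generic_forms h"
  shows "is_lead \<tau> (dist_mon h s) (single (Min UNIV) (pp_deg s))"
proof -
  have lead: "is_lead \<tau> (h i j) (single (Min UNIV) 1)" if "j \<ge> 1" for i j
    using is_lead_linear[OF \<tau>] generic_forms_homogeneous[OF h that] generic_forms_first[OF h that] by blast
  have "is_lead \<tau> (\<Prod>j=1..lookup s i. h i j) (\<Sum>j=1..lookup s i. single (Min UNIV) 1)" for i
    by (intro is_lead_prod[OF \<tau>] lead) simp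
  then have "is_lead \<tau> (dist_mon h s) (\<Sum>i\<in>UNIV. \<Sum>j=1..lookup s i. single (Min UNIV) 1)"
    unfolding dist_mon_def by (rule is_lead_prod[OF \<tau>])
  also have "(\<Sum>i\<in>UNIV. \<Sum>j=1..lookup s i. single (Min UNIV :: 'n) (1 :: nat)) = single (Min UNIV) (pp_deg s)"
    by (simp add: sum_const_single pp_deg_def del: sum_constant) (simp add: sum_const_single)
  finally show ?thesis .
qed

text \<open>By induction on the degree, multiplying \<open>distraction h p\<close> by a combination of the forms
  \<open>h k (w k + 1)\<close> that is congruent to \<open>x\<^sub>i\<close> modulo \<open>x\<^bsub>j+1\<^esub>, \<dots>, x\<^sub>n\<close>. This combination depends
  on the term \<open>w\<close> of \<open>p\<close>, so in general only a congruence modulo these variables survives, which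
  suffices for DegRevLex. If the forms do not depend on their second index, then neither
  does the combination, and leading power products multiply for any ordering.\<close>
lemma is_lead_distraction_exists:
  fixes h :: "'n::{finite,linorder} \<Rightarrow> nat \<Rightarrow> ('n, 'a::field) mpoly"
  assumes \<tau>: "term_ordering \<tau>" and h: "generic_forms h"
    and cases: "\<tau> = drl \<or> (\<forall>i. \<forall>k\<ge>1. h i k = h i 1)"
    and u: "\<And>k. j < k \<Longrightarrow> lookup u k = 0"
  obtains p where "keys p \<subseteq> {w. (\<forall>k>j. lookup w k = 0) \<and> pp_deg w = pp_deg u}"
    and "is_lead \<tau> (distraction h p) u"
proof -
  define W where "W d = {w :: 'n pp. (\<forall>k>j. lookup w k = 0) \<and> pp_deg w = d}" for d
  have W_add: "{w + single k 1 | w k. w \<in> keys p \<and> k \<in> {..j}} \<subseteq> W (Suc d)"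
    if "keys p \<subseteq> W d" for p :: "('n, 'a) mpoly" and d
    using that by (force simp: W_def lookup_add pp_deg_add lookup_single when_def)
  define N where "N = {s :: 'n pp. \<exists>k>j. lookup s k \<noteq> 0}"
  have N: "up_closed N"
    by (auto simp: up_closed_def N_def lookup_add)
  \<comment> \<open>Congruences modulo \<open>mon_space N\<close>, the ideal generated by the
    variables beyond \<open>j\<close>, add up over the terms of \<open>p\<close>; leads need not.
    Hence the induction carries a different invariant in each case.\<close>
  define good where "good v u \<longleftrightarrow> (if \<tau> = drl then v - mon u \<in> mon_space N else is_lead \<tau> v u)"
    for v :: "('n, 'a) mpoly" and u
  have "\<exists>p. keys p \<subseteq> W (pp_deg u) \<and> good (distraction h p) u"
    using u
  proof (induction "pp_deg u" arbitrary: u)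
    case 0
    then have "u = 0" by (simp add: pp_deg_eq_0_iff)
    then have "keys (mon 0 :: ('n, 'a) mpoly) \<subseteq> W (pp_deg u)"
      unfolding keys_mon by (simp add: W_def)
    moreover have "good (distraction h (mon 0)) u"
      using is_lead_mon[OF \<tau>, of 0, where 'a = 'a] \<open>u = 0\<close>
      by (simp only: good_def distraction_mon dist_mon_0) (simp add: mon_space_0)
    ultimately show ?case by blast
  next
    case (Suc d)
    then have "u \<noteq> 0" by auto
    then obtain i where i: "lookup u i \<noteq> 0"
      by (metis lookup_zero poly_mapping_eqI)
    with Suc.prems[of i] have "i \<le> j" by (auto simp: not_less[symmetric])
    define u' where "u' = u - single i 1"
    have u_eq: "u = u' + single i 1"
      unfolding u'_def using i by (intro pp_diff_add[symmetric]) (auto simp: lookup_single when_def)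
    then have deg: "pp_deg u = Suc (pp_deg u')" by (simp add: pp_deg_add)
    have "lookup u' k = 0" if "j < k" for k
      using Suc.prems[OF that] by (simp add: u'_def lookup_minus)
    then obtain p where p: "keys p \<subseteq> W d" "good (distraction h p) u'"
      using Suc.hyps(1)[of u'] Suc.hyps(2) deg by auto
    show ?case
    proof (cases "\<tau> = drl")
      case True
      have "\<forall>w. \<exists>\<beta>. keys ((\<Sum>k\<le>j. const (\<beta> k) * h k (lookup w k + 1)) - Var i) \<subseteq> {single r 1 | r. j < r}"
        by (rule allI, rule generic_forms_span[OF h _ \<open>i \<le> j\<close>]) simp
      from choice[OF this] obtain \<beta> where \<beta>: "\<And>w. keys ((\<Sum>k\<le>j. const (\<beta> w k) * h k (lookup w k + 1)) - Var i) \<subseteq> {single r 1 | r. j < r}"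
        by blast
      define m where "m w = (\<Sum>k\<le>j. const (\<beta> w k) * h k (lookup w k + 1))" for w
      have m: "m w - Var i \<in> mon_space N" for w
        using \<beta>[of w] by (fastforce simp: mon_space_def N_def m_def)
      obtain p' where p': "keys p' \<subseteq> {w + single k 1 | w k. w \<in> keys p \<and> k \<in> {..j}}"
        "distraction h p' = (\<Sum>w\<in>keys p. const (lookup p w) * (m w * dist_mon h w))"
        using distraction_step[of p "{..j}" h \<beta>] unfolding m_def by blast
      \<comment> \<open>The error splits into the termwise errors \<open>m w - Var i\<close> and x_i
        times the error inherited from \<open>u'\<close>; both lie in the ideal
        \<open>mon_space N\<close>.\<close>
      have "distraction h p' - mon u = (\<Sum>w\<in>keys p. const (lookup p w) * dist_mon h w * (m w - Var i))
          + Var i * (distraction h p - mon u')"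
        unfolding p'(2) unfolding distraction_eq_lin_ext lin_ext_def u_eq mon_add Var_def
        by (simp add: algebra_simps sum_subtractf sum_distrib_left)
      also have "\<dots> \<in> mon_space N"
        using p(2) True
        by (intro mon_space_add mon_space_sum mon_space_mult[OF N] m) (simp add: good_def)
      finally have "good (distraction h p') u" using True by (simp add: good_def)
      moreover have "keys p' \<subseteq> W (pp_deg u)"
        using p'(1) W_add[OF p(1)] unfolding Suc.hyps(2) by (rule subset_trans)
      ultimately show ?thesis by blast
    next
      case False
      with cases have h_const: "\<forall>i. \<forall>k\<ge>1. h i k = h i 1" by blast
      have const: "h k (lookup w k + 1) = h k 1" for k w
        by (rule h_const[rule_format]) simp
      obtain \<beta> where \<beta>: "keys ((\<Sum>k\<le>j. const (\<beta> k) * h k 1) - Var i) \<subseteq> {single r 1 | r. j < r}"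
        using generic_forms_span[OF h _ \<open>i \<le> j\<close>, of "\<lambda>_. 1"] by auto
      define m where "m = (\<Sum>k\<le>j. const (\<beta> k) * h k 1)"
      have keys_m: "keys (m - Var i) \<subseteq> {single r 1 | r. j < r}"
        using \<beta> by (simp add: m_def)
      \<comment> \<open>Besides x_i, only variables beyond \<open>j\<close> occur in
        \<open>m\<close>; they are smaller than x_i since \<open>i \<le> j\<close>.\<close>
      have "is_lead \<tau> m (single i 1)"
        unfolding is_lead_def
      proof (intro conjI ballI)
        have "single i 1 \<noteq> single r (1::nat)" if "j < r" for r
          using \<open>i \<le> j\<close> that by (metis leD lookup_single_eq lookup_single_not_eq zero_neq_one)
        then have "single i 1 \<notin> keys (m - Var i)"
          using keys_m by blast
        then show "lookup m (single i 1) \<noteq> 0"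
          by (simp add: in_keys_iff lookup_minus Var_def mon_def)
        fix s assume "s \<in> keys m"
        then have "s = single i 1 \<or> s \<in> keys (m - Var i)"
          by (auto simp: in_keys_iff lookup_minus Var_def mon_def lookup_single when_def)
        then obtain r where "s = single r 1" "i \<le> r"
          using keys_m \<open>i \<le> j\<close> by fastforce
        then show "(s, single i 1) \<in> \<tau>"
          using term_ordering_single[OF \<tau>] by simp
      qed
      moreover have "is_lead \<tau> (distraction h p) u'"
        using p(2) False by (simp add: good_def)
      ultimately have "is_lead \<tau> (distraction h p * m) u"
        unfolding u_eq by (intro is_lead_mult[OF \<tau>])
      moreover obtain p' where p': "keys p' \<subseteq> {w + single k 1 | w k. w \<in> keys p \<and> k \<in> {..j}}"
        "distraction h p' = (\<Sum>w\<in>keys p. const (lookup p w) * (m * dist_mon h w))"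
        using distraction_step[of p "{..j}" h "\<lambda>_. \<beta>"] unfolding m_def const by blast
      moreover have "distraction h p' = distraction h p * m"
        unfolding p'(2) unfolding distraction_eq_lin_ext lin_ext_def
        by (simp add: sum_distrib_left sum_distrib_right ac_simps)
      ultimately have "good (distraction h p') u" using False by (simp add: good_def)
      moreover have "keys p' \<subseteq> W (pp_deg u)"
        using p'(1) W_add[OF p(1)] unfolding Suc.hyps(2) by (rule subset_trans)
      ultimately show ?thesis by blast
    qed
  qed
  then obtain p where p: "keys p \<subseteq> W (pp_deg u)" "good (distraction h p) u" by blast
  have "is_lead \<tau> (distraction h p) u"
  proof (cases "\<tau> = drl")
    case True
    have "p \<in> homogeneous_component (pp_deg u)"
      using p(1) by (auto simp: homogeneous_component_def W_def)
    then have "distraction h p \<in> homogeneous_component (pp_deg u)"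
      by (intro homogeneous_distraction generic_forms_homogeneous[OF h])
    then show ?thesis
      unfolding True using p(2) True u
      by (intro is_lead_drlI[of _ u j]) (simp_all add: good_def N_def)
  qed (use p(2) in \<open>simp add: good_def\<close>)
  with p(1) show ?thesis using that by (simp add: W_def)
qed

text \<open>At the last index no later variables remain, so the termwise combinations equal x_i
  exactly and multiply the whole distraction by x_i.\<close>

lemma distraction_image_Var_times:
  fixes h :: "'n::{finite,linorder} \<Rightarrow> nat \<Rightarrow> ('n, 'a::field) mpoly"
  assumes h: "generic_forms h" and M: "up_closed M" and v: "v \<in> distraction h ` mon_space M"
  shows "Var i * v \<in> distraction h ` mon_space M"
proof -
  obtain p where p: "v = distraction h p" "keys p \<subseteq> M" using v by (auto simp: mon_space_def)
  define j where "j = Max (UNIV :: 'n set)"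
  have "i \<le> j" by (simp add: j_def)
  have "\<exists>\<beta>. keys ((\<Sum>k\<le>j. const (\<beta> k) * h k (lookup w k + 1)) - Var i) \<subseteq> {single r 1 | r. j < r}" for w
    by (rule generic_forms_span[OF h _ \<open>i \<le> j\<close>]) simp
  moreover have "{single r 1 | r. j < r} = ({} :: 'n pp set)"
    by (auto simp: j_def not_less)
  ultimately have "\<forall>w. \<exists>\<beta>. (\<Sum>k\<le>j. const (\<beta> k) * h k (lookup w k + 1)) = Var i"
    by simp
  from choice[OF this] obtain \<beta> where \<beta>: "\<And>w. (\<Sum>k\<le>j. const (\<beta> w k) * h k (lookup w k + 1)) = Var i"
    by blast
  obtain p' where p': "keys p' \<subseteq> {w + single k 1 | w k. w \<in> keys p \<and> k \<in> {..j}}"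
    "distraction h p' = (\<Sum>w\<in>keys p. const (lookup p w) * (Var i * dist_mon h w))"
    using distraction_step[of p "{..j}" h \<beta>] unfolding \<beta> by blast
  have "distraction h p' = Var i * v"
    unfolding p'(2) p(1) unfolding distraction_eq_lin_ext lin_ext_def
    by (simp add: sum_distrib_left ac_simps)
  moreover have "w + single k 1 \<in> M" if "w \<in> keys p" for w k
    using that p(2) M by (metis add.commute subsetD up_closed_def)
  then have "p' \<in> mon_space M"
    using p'(1) by (auto simp: mon_space_def)
  ultimately show ?thesis by (metis image_eqI)
qed

lemma distraction_image_lead_up_closed:
  fixes h :: "'n::{finite,linorder} \<Rightarrow> nat \<Rightarrow> ('n, 'a::field) mpoly"
  assumes h: "generic_forms h" and M: "up_closed M" and \<tau>: "term_ordering \<tau>"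
    and v: "v \<in> distraction h ` mon_space M" "is_lead \<tau> v u"
  shows "\<exists>v'\<in>distraction h ` mon_space M. is_lead \<tau> v' (r + u)"
proof (induction "pp_deg r" arbitrary: r)
  case 0
  then show ?case using v by (auto simp: pp_deg_eq_0_iff)
next
  case (Suc d)
  then have "r \<noteq> 0" by auto
  then obtain i where i: "lookup r i \<noteq> 0"
    by (metis lookup_zero poly_mapping_eqI)
  define r' where "r' = r - single i 1"
  have r_eq: "r = r' + single i 1"
    unfolding r'_def using i by (intro pp_diff_add[symmetric]) (auto simp: lookup_single when_def)
  then have "d = pp_deg r'" using Suc.hyps(2) by (simp add: pp_deg_add)
  then obtain v' where v': "v' \<in> distraction h ` mon_space M" "is_lead \<tau> v' (r' + u)"
    using Suc.hyps(1) by blast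
  have "is_lead \<tau> (Var i * v') (single i 1 + (r' + u))"
    unfolding Var_def by (intro is_lead_mult[OF \<tau>] is_lead_mon[OF \<tau>] v')
  then show ?case
    using distraction_image_Var_times[OF h M v'(1), of i] by (metis r_eq add.assoc add.commute)
qed

text \<open>A divisor \<open>u0\<close> of \<open>u\<close> of degree \<open>pp_deg t\<close> is
  written as a power of x_1 of degree \<open>b\<close> times \<open>w\<close>. The power of x_1 is
  the lead of the distraction of \<open>l = head j t\<close>, and \<open>w\<close> is the lead of a
  distraction by the remaining forms \<open>shift l h\<close>. Multiplication by variables leads
  from \<open>u0\<close> to \<open>u\<close>.\<close>

lemma gin_pps_lead:
  fixes h :: "'n::{finite,linorder} \<Rightarrow> nat \<Rightarrow> ('n, 'a::field) mpoly"
  assumes \<tau>: "term_ordering \<tau>" and h: "generic_forms h"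
    and cases: "\<tau> = drl \<or> (\<forall>i. \<forall>k\<ge>1. h i k = h i 1)"
    and u: "u \<in> gin_pps t"
  shows "\<exists>v\<in>distraction h ` mon_space (stable_pps t). is_lead \<tau> v u"
proof -
  from u obtain j where j: "(\<Sum>k<j. lookup t k) \<le> lookup u (Min UNIV)" "pp_deg t \<le> (\<Sum>k\<le>j. lookup u k)"
    by (auto simp: gin_pps_def)
  define b where "b = (\<Sum>k<j. lookup t k)"
  define l where "l = head j t"
  have deg_l: "pp_deg l = b" by (simp add: l_def b_def pp_deg_head)
  define r where "r = pp_of (\<lambda>k. if k \<le> j then lookup u k else 0)"
  have "pp_deg r = (\<Sum>k\<le>j. lookup u k)"
    unfolding pp_deg_def r_def using sum.inter_restrict[of UNIV "lookup u" "{..j}"] by simp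
  moreover have "lookup (single (Min UNIV) b) k \<le> lookup r k" for k
    using j(1) by (auto simp: lookup_single when_def r_def b_def)
  moreover have "b \<le> pp_deg t"
    by (simp add: b_def pp_deg_split[of t j])
  ultimately obtain u0 where u0: "\<And>k. lookup (single (Min UNIV) b) k \<le> lookup u0 k"
    "\<And>k. lookup u0 k \<le> lookup r k" "pp_deg u0 = pp_deg t"
    using j(2) pp_between[of "single (Min UNIV) b" r "pp_deg t"] by auto
  define w where "w = u0 - single (Min UNIV) b"
  have u0_eq: "u0 = w + single (Min UNIV) b"
    unfolding w_def using u0(1) by (intro pp_diff_add[symmetric])
  have deg_w: "pp_deg w + b = pp_deg t"
    using u0(3) by (simp add: u0_eq pp_deg_add)
  have w: "lookup w k = 0" if "j < k" for k
    using u0(2)[of k] that by (simp add: w_def lookup_minus r_def leD split: if_splits)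
  have shift_cases: "\<tau> = drl \<or> (\<forall>i. \<forall>k\<ge>1. shift l h i k = shift l h i 1)"
    using cases
  proof
    assume const: "\<forall>i. \<forall>k\<ge>1. h i k = h i 1"
    have "shift l h i k = h i 1" if "k \<ge> 1" for i k
      unfolding shift_def using const that trans_le_add2 by blast
    then show ?thesis by simp
  qed simp
  obtain q where q: "keys q \<subseteq> {x. (\<forall>k>j. lookup x k = 0) \<and> pp_deg x = pp_deg w}"
    "is_lead \<tau> (distraction (shift l h) q) w"
    using is_lead_distraction_exists[OF \<tau> generic_forms_shift[OF h] shift_cases w] by blast
  have "is_lead \<tau> (distraction h (mon l * q)) (single (Min UNIV) b + w)"
    unfolding distraction_mon_times
    by (intro is_lead_mult[OF \<tau>] q(2)) (use is_lead_dist_mon[OF \<tau> h, of l] deg_l in simp)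
  then have lead: "is_lead \<tau> (distraction h (mon l * q)) u0"
    by (simp add: u0_eq add.commute)
  \<comment> \<open>The variables of \<open>x\<close> do not go beyond \<open>j\<close>, so the
    whole degree \<open>b + pp_deg w = pp_deg t\<close> is already reached by the partial sum up to
    \<open>j\<close>.\<close>
  have "l + x \<in> stable_pps t" if "x \<in> keys q" for x
  proof -
    from that q(1) have x: "\<forall>k>j. lookup x k = 0" "pp_deg x = pp_deg w" by auto
    have "(\<Sum>k\<le>j. lookup x k) = pp_deg x"
      unfolding pp_deg_def using x(1) by (intro sum.mono_neutral_left) (auto simp: not_le)
    moreover have "{..j} \<inter> {..<j} = {..<j}" by auto
    then have "(\<Sum>k\<le>j. lookup l k) = b"
      by (simp add: l_def sum_head b_def)
    ultimately have "pp_deg t \<le> (\<Sum>k\<le>j. lookup (l + x) k)"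
      using deg_w x(2) by (simp add: lookup_add sum.distrib)
    then show ?thesis
      unfolding stable_pps_def
      by (auto simp: lookup_add l_def lookup_head intro!: exI[of _ j])
  qed
  then have "mon l * q \<in> mon_space (stable_pps t)"
    using keys_mult[of "mon l" q] by (auto simp: mon_space_def)
  moreover have "lookup u0 k \<le> lookup u k" for k
    using u0(2)[of k] by (simp add: r_def split: if_splits)
  then have "u = (u - u0) + u0"
    by (intro pp_diff_add[symmetric])
  ultimately show ?thesis
    using distraction_image_lead_up_closed[OF h up_closed_stable_pps \<tau> imageI lead, of t "u - u0"] by simp
qed

text \<open>Distraction preserves degrees, so keeping only the terms of \<open>p\<close> of degree
  \<open>pp_deg u\<close> yields the homogeneous component of \<open>v\<close> containing
  \<open>u\<close>. It has the same lead and lies in a space spanned by a finite set.\<close>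

lemma distraction_lead_in_span:
  fixes h :: "'n::{finite,linorder} \<Rightarrow> nat \<Rightarrow> ('n, 'a::field) mpoly"
  assumes h: "generic_forms h" and v: "v \<in> distraction h ` mon_space M" "is_lead \<tau> v u"
  shows "\<exists>v'\<in>K_span (dist_mon h ` {s \<in> M. pp_deg s = pp_deg u}). is_lead \<tau> v' u"
proof -
  obtain p where p: "v = distraction h p" "keys p \<subseteq> M" using v by (auto simp: mon_space_def)
  let ?f = "\<lambda>s. const (lookup p s) * dist_mon h s"
  define v' where "v' = (\<Sum>s\<in>{s \<in> keys p. pp_deg s = pp_deg u}. ?f s)"
  have "v' \<in> K_span (dist_mon h ` {s \<in> M. pp_deg s = pp_deg u})"
    unfolding v'_def K_span_def using p(2)
    by (intro module.span_sum[OF module_const] module.span_scale[OF module_const] module.span_base[OF module_const])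
      auto
  moreover have "is_lead \<tau> v' u"
  proof -
    have f: "?f s \<in> homogeneous_component (pp_deg s)" for s
      using homogeneous_dist_mon[of h s, OF generic_forms_homogeneous[OF h]] mon_space_const_mult
      unfolding homogeneous_component_eq by blast
    have "v' \<in> homogeneous_component (pp_deg u)"
      unfolding v'_def homogeneous_component_eq
    proof (intro mon_space_sum)
      fix s assume "s \<in> {s \<in> keys p. pp_deg s = pp_deg u}"
      with f[of s] show "?f s \<in> mon_space {s. pp_deg s = pp_deg u}"
        by (simp add: homogeneous_component_eq)
    qed
    then have zero: "lookup v' s = 0" if "pp_deg s \<noteq> pp_deg u" for s
      using that by (auto simp: homogeneous_component_def in_keys_iff)
    have "v - v' = (\<Sum>s\<in>keys p - {s \<in> keys p. pp_deg s = pp_deg u}. ?f s)"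
      unfolding v'_def p(1) distraction_eq_lin_ext lin_ext_def
      by (subst sum_diff) auto
    also have "\<dots> \<in> mon_space {s. pp_deg s \<noteq> pp_deg u}"
    proof (intro mon_space_sum)
      fix s assume "s \<in> keys p - {s \<in> keys p. pp_deg s = pp_deg u}"
      with f[of s] show "?f s \<in> mon_space {s. pp_deg s \<noteq> pp_deg u}"
        by (auto simp: homogeneous_component_def mon_space_def)
    qed
    finally have diff: "v - v' \<in> mon_space {s. pp_deg s \<noteq> pp_deg u}" .
    have eq: "lookup v' s = lookup v s" if "pp_deg s = pp_deg u" for s
    proof -
      have "s \<notin> keys (v - v')" using diff that by (auto simp: mon_space_def)
      then show ?thesis by (simp add: in_keys_iff lookup_minus)
    qed
    show ?thesis
      unfolding is_lead_def
    proof (intro conjI ballI)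
      show "lookup v' u \<noteq> 0" using v(2) eq[of u] by (simp add: is_lead_def)
      fix s assume "s \<in> keys v'"
      then have "s \<in> keys v" using zero[of s] eq[of s] by (cases "pp_deg s = pp_deg u") (auto simp: in_keys_iff)
      then show "(s, u) \<in> \<tau>" using v(2) by (simp add: is_lead_def)
    qed
  qed
  ultimately show ?thesis by blast
qed

theorem initial_ideal_distraction:
  fixes h :: "'n::{finite,linorder} \<Rightarrow> nat \<Rightarrow> ('n, 'a::field) mpoly"
  assumes \<tau>: "term_ordering \<tau>" and h: "generic_forms h"
    and cases: "\<tau> = drl \<or> (\<forall>i. \<forall>k\<ge>1. h i k = h i 1)"
  shows "initial_ideal \<tau> (distraction h ` mon_space (stable_pps t)) = mon_space (gin_pps t)"
proof (rule initial_ideal_eqI[OF \<tau> up_closed_gin_pps])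
  show "\<exists>v\<in>distraction h ` mon_space (stable_pps t). is_lead \<tau> v u" if "u \<in> gin_pps t" for u
    by (rule gin_pps_lead[OF \<tau> h cases that])
next
  fix v u assume v: "v \<in> distraction h ` mon_space (stable_pps t)" "is_lead \<tau> v u"
  define e where "e = pp_deg u"
  define B where "B = dist_mon h ` {s \<in> stable_pps t. pp_deg s = e}"
  define U where "U = {x. \<exists>p\<in>K_span B. is_lead \<tau> p x}"
  have fin: "finite {s \<in> stable_pps t. pp_deg s = e}"
    by (rule finite_subset[OF _ finite_pp_deg[of e]]) auto
  then have "finite B" by (simp add: B_def)
  note U = card_leads_le[OF \<tau> this, folded U_def]
  \<comment> \<open>The left side is contained in \<open>U\<close>, while \<open>card U\<close> is
    at most \<open>card B\<close>, hence at most the number of power products of degree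
    \<open>e\<close> in \<open>stable_pps t\<close>, which the counting lemma bounds by the size of
    the left side.\<close>
  have "{s \<in> gin_pps t. pp_deg s = e} = U"
  proof (rule card_seteq[OF U(1)])
    show "{s \<in> gin_pps t. pp_deg s = e} \<subseteq> U"
    proof
      fix s assume s: "s \<in> {s \<in> gin_pps t. pp_deg s = e}"
      then obtain v' where "v' \<in> distraction h ` mon_space (stable_pps t)" "is_lead \<tau> v' s"
        using gin_pps_lead[OF \<tau> h cases, of s t] by blast
      then show "s \<in> U"
        using distraction_lead_in_span[OF h, of v' "stable_pps t" \<tau> s] s by (simp add: U_def B_def)
    qed
    show "card U \<le> card {s \<in> gin_pps t. pp_deg s = e}"
      using U(2) card_image_le[OF fin, of "dist_mon h"] card_stable_pps_le[of t e]
      by (simp add: B_def)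
  qed
  moreover have "u \<in> U"
    using distraction_lead_in_span[OF h v] by (simp add: U_def B_def e_def)
  ultimately show "u \<in> gin_pps t" by auto
qed


section \<open>Polynomial functions on matrices\<close>

lemma eval_poly_eq_lin_ext:
  fixes v :: "'n::finite \<Rightarrow> 'a::comm_ring_1"
  shows "eval_poly v = lin_ext (\<lambda>x. x) (\<lambda>t. \<Prod>i\<in>UNIV. v i ^ lookup t i)"
proof -
  have "(\<Prod>i\<in>keys t. v i ^ lookup t i) = (\<Prod>i\<in>UNIV. v i ^ lookup t i)" for t :: "'n pp"
    by (rule prod.mono_neutral_left) (auto simp: in_keys_iff)
  then show ?thesis
    by (simp add: eval_poly_def lin_ext_def fun_eq_iff)
qed

lemma prod_power_single: "(\<Prod>i\<in>UNIV. v i ^ lookup (single k 1) i) = v k"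
  for v :: "'n::finite \<Rightarrow> 'a::comm_ring_1"
proof -
  have "v i ^ lookup (single k 1) i = (if i = k then v i else 1)" for i
    by (simp add: lookup_single when_def)
  then show ?thesis by simp
qed

text \<open>Only the function is kept, so that closure under sums, products and determinants
  replaces calculations with polynomials in the n^2 matrix entries.\<close>

definition poly_fun :: "('a::field^'n^'n \<Rightarrow> 'a) \<Rightarrow> bool"
  where "poly_fun F \<longleftrightarrow> (\<exists>f. \<forall>g. F g = eval_poly (\<lambda>(i, j). g $ i $ j) f)"

lemma poly_fun_const: "poly_fun (\<lambda>g. c)"
  unfolding poly_fun_def
  by (rule exI[of _ "const c"])
    (simp add: eval_poly_eq_lin_ext const_def lin_ext_single[OF coeff_hom_id])

lemma poly_fun_entry: "poly_fun (\<lambda>g. g $ i $ j)"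
  unfolding poly_fun_def
  by (rule exI[of _ "Var (i, j)"])
    (simp add: eval_poly_eq_lin_ext Var_def lin_ext_mon[OF coeff_hom_id] prod_power_single del: One_nat_def)

lemma poly_fun_add: "poly_fun F \<Longrightarrow> poly_fun G \<Longrightarrow> poly_fun (\<lambda>g. F g + G g)"
proof -
  assume "poly_fun F" "poly_fun G"
  then obtain p q where "\<And>g. F g = eval_poly (\<lambda>(i, j). g $ i $ j) p" "\<And>g. G g = eval_poly (\<lambda>(i, j). g $ i $ j) q"
    unfolding poly_fun_def by blast
  then show ?thesis
    unfolding poly_fun_def eval_poly_eq_lin_ext
    by (intro exI[of _ "p + q"] allI) (simp add: lin_ext_add[OF coeff_hom_id])
qed

lemma poly_fun_mult: "poly_fun F \<Longrightarrow> poly_fun G \<Longrightarrow> poly_fun (\<lambda>g. F g * G g)"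
proof -
  assume "poly_fun F" "poly_fun G"
  then obtain p q where "\<And>g. F g = eval_poly (\<lambda>(i, j). g $ i $ j) p" "\<And>g. G g = eval_poly (\<lambda>(i, j). g $ i $ j) q"
    unfolding poly_fun_def by blast
  then show ?thesis
    unfolding poly_fun_def eval_poly_eq_lin_ext
    by (intro exI[of _ "p * q"] allI)
      (simp add: lin_ext_mult[OF coeff_hom_id] lookup_add power_add prod.distrib)
qed

lemma poly_fun_sum: "(\<And>i. i \<in> A \<Longrightarrow> poly_fun (F i)) \<Longrightarrow> poly_fun (\<lambda>g. \<Sum>i\<in>A. F i g)"
  by (induction A rule: infinite_finite_induct) (simp_all add: poly_fun_const poly_fun_add)

lemma poly_fun_prod: "(\<And>i. i \<in> A \<Longrightarrow> poly_fun (F i)) \<Longrightarrow> poly_fun (\<lambda>g. \<Prod>i\<in>A. F i g)"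
  by (induction A rule: infinite_finite_induct) (simp_all add: poly_fun_const poly_fun_mult)

lemma poly_fun_det:
  assumes "\<And>i j. poly_fun (\<lambda>g. A g $ i $ j)"
  shows "poly_fun (\<lambda>g. det (A g))"
  unfolding det_def by (intro poly_fun_sum poly_fun_mult poly_fun_const poly_fun_prod assms)

text \<open>Substituting linear polynomials in one variable for the matrix entries restricts
  \<open>F\<close> to the line through \<open>g\<close> (at 0) and \<open>g'\<close> (at 1).\<close>

lemma poly_fun_on_line:
  fixes g g' :: "'a::field^'n^'n"
  assumes "poly_fun F"
  obtains p :: "'a poly" where "\<And>s. poly p s = F (\<chi> i j. g $ i $ j + s * (g' $ i $ j - g $ i $ j))"
proof -
  obtain f where f: "\<And>x. F x = eval_poly (\<lambda>(i, j). x $ i $ j) f"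
    using assms by (auto simp: poly_fun_def)
  define p where "p = (\<Sum>t\<in>keys f. [:lookup f t:] *
    (\<Prod>k\<in>UNIV. [:g $ fst k $ snd k, g' $ fst k $ snd k - g $ fst k $ snd k:] ^ lookup t k))"
  have "poly p s = F (\<chi> i j. g $ i $ j + s * (g' $ i $ j - g $ i $ j))" for s
    unfolding f eval_poly_eq_lin_ext lin_ext_def p_def
    by (simp add: poly_sum poly_prod split_beta)
  then show ?thesis using that by blast
qed

text \<open>On the line through \<open>g\<close> and \<open>g'\<close> both functions become nonzero
  univariate polynomials. Their product has finitely many roots, and an infinite field has a further
  point.\<close>

lemma poly_fun_mult_nonzero:
  fixes F G :: "'a::field^'n^'n \<Rightarrow> 'a"
  assumes inf: "infinite (UNIV :: 'a set)" and F: "poly_fun F" "F g \<noteq> 0" and G: "poly_fun G" "G g' \<noteq> 0"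
  obtains x where "F x \<noteq> 0" "G x \<noteq> 0"
proof -
  let ?line = "\<lambda>s. \<chi> i j. g $ i $ j + s * (g' $ i $ j - g $ i $ j)"
  have line: "?line 0 = g" "?line 1 = g'" by (simp_all add: vec_eq_iff)
  obtain p where p: "\<And>s. poly p s = F (?line s)" using poly_fun_on_line[OF F(1)] by blast
  obtain q where q: "\<And>s. poly q s = G (?line s)" using poly_fun_on_line[OF G(1)] by blast
  have "p \<noteq> 0" using p[of 0] F(2) unfolding line by auto
  moreover have "q \<noteq> 0" using q[of 1] G(2) unfolding line by auto
  ultimately have "finite {s. poly (p * q) s = 0}" by (intro poly_roots_finite) simp
  then obtain s where "s \<notin> {s. poly (p * q) s = 0}" using ex_new_if_finite[OF inf] by blast
  then show ?thesis using that[of "?line s"] p q by simp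
qed

lemma poly_fun_prod_nonzero:
  fixes F :: "'i \<Rightarrow> 'a::field^'n^'n \<Rightarrow> 'a"
  assumes inf: "infinite (UNIV :: 'a set)" and "finite A"
    and "\<And>i. i \<in> A \<Longrightarrow> poly_fun (F i)" "\<And>i. i \<in> A \<Longrightarrow> \<exists>g. F i g \<noteq> 0"
  shows "\<exists>g. (\<Prod>i\<in>A. F i g) \<noteq> 0"
  using assms(2-4)
proof (induction A rule: finite_induct)
  case (insert i A)
  then obtain g g' where g: "F i g \<noteq> 0" "(\<Prod>i\<in>A. F i g') \<noteq> 0" by blast
  have F: "poly_fun (F i)" "poly_fun (\<lambda>g. \<Prod>i\<in>A. F i g)"
    using insert.prems by (auto intro: poly_fun_prod)
  obtain x where "F i x \<noteq> 0" "(\<Prod>i\<in>A. F i x) \<noteq> 0"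
    using poly_fun_mult_nonzero[of "F i" g "\<lambda>g. \<Prod>i\<in>A. F i g" g', OF inf F(1) g(1) F(2) g(2)] by blast
  then show ?case using insert.hyps by (intro exI[of _ x]) simp
qed simp

text \<open>Any competing ideal is attained on another nonempty open set; a matrix in both open sets
  forces the two ideals to coincide.\<close>

lemma gin_eqI:
  fixes J :: "('n::{finite,linorder}, 'a::field) mpoly set"
  assumes inf: "infinite (UNIV :: 'a set)" and M: "monomial_ideal M"
    and F: "poly_fun F" "F g0 \<noteq> 0"
    and init: "\<And>g. invertible g \<Longrightarrow> F g \<noteq> 0 \<Longrightarrow> initial_ideal \<tau> (gl_act g ` J) = M"
  shows "gin \<tau> J = M"
  unfolding gin_def
proof (rule the_equality)
  have "poly_fun (\<lambda>g. det g)"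
    using poly_fun_det[of "\<lambda>g. g"] poly_fun_entry by blast
  \<comment> \<open>The factor \<open>det g\<close> ensures that the common point of the two open
    sets is invertible.\<close>
  then have FD: "poly_fun (\<lambda>g. F g * det g)" using F(1) by (intro poly_fun_mult)
  have "det (mat 1 :: (('a, 'n) vec, 'n) vec) \<noteq> 0" by simp
  then obtain g1 where "F g1 \<noteq> 0" "det g1 \<noteq> 0"
    using poly_fun_mult_nonzero[OF inf F \<open>poly_fun (\<lambda>g. det g)\<close>] by blast
  then have g1: "F g1 * det g1 \<noteq> 0" by simp
  from F(1) obtain f where f: "\<And>g. F g = eval_poly (\<lambda>(i, j). g $ i $ j) f"
    by (auto simp: poly_fun_def)
  let ?U = "{g. invertible g \<and> F g \<noteq> 0}"
  have "zariski_open_GL ?U"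
    unfolding zariski_open_GL_def by (intro exI[of _ "{f}"]) (simp add: f)
  moreover have "g1 \<in> ?U" using g1 by (simp add: invertible_det_nz)
  ultimately show "monomial_ideal M \<and> (\<exists>U. zariski_open_GL U \<and> U \<noteq> {} \<and> (\<forall>g\<in>U. initial_ideal \<tau> (gl_act g ` J) = M))"
    using M init by (intro conjI exI[of _ ?U]) auto
  fix M' assume "monomial_ideal M' \<and> (\<exists>U. zariski_open_GL U \<and> U \<noteq> {} \<and> (\<forall>g\<in>U. initial_ideal \<tau> (gl_act g ` J) = M'))"
  then obtain U where U: "zariski_open_GL U" "U \<noteq> {}" "\<And>g. g \<in> U \<Longrightarrow> initial_ideal \<tau> (gl_act g ` J) = M'"
    by blast
  from U(1) obtain P where P: "U = {g. invertible g \<and> (\<exists>f\<in>P. eval_poly (\<lambda>(i, j). g $ i $ j) f \<noteq> 0)}"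
    by (auto simp: zariski_open_GL_def)
  with U(2) obtain g2 f' where f': "f' \<in> P" "eval_poly (\<lambda>(i, j). g2 $ i $ j) f' \<noteq> 0" by auto
  have F': "poly_fun (\<lambda>g. eval_poly (\<lambda>(i, j). g $ i $ j) f')" by (auto simp: poly_fun_def)
  obtain g where g: "F g * det g \<noteq> 0" "eval_poly (\<lambda>(i, j). g $ i $ j) f' \<noteq> 0"
    using poly_fun_mult_nonzero[OF inf FD _ F', of g1 g2] g1 f'(2) by blast
  then have "invertible g" by (simp add: invertible_det_nz)
  with g f'(1) have "g \<in> U" by (auto simp: P)
  with U(3) init[OF \<open>invertible g\<close>] g(1) show "M' = M" by auto
qed


section \<open>Generic coordinate changes of distractions\<close>

lemma gl_act_eq_lin_ext:
  "gl_act g = lin_ext const (\<lambda>t. \<Prod>j\<in>UNIV. (\<Sum>i\<in>UNIV. const (g $ i $ j) * Var i) ^ lookup t j)"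
  by (rule ext) (simp add: gl_act_def lin_ext_def)

lemma gl_act_mult: "gl_act g (p * q) = gl_act g p * gl_act g q"
  unfolding gl_act_eq_lin_ext
  by (rule lin_ext_mult[OF coeff_hom_const]) (simp add: lookup_add power_add prod.distrib)

lemma gl_act_const_times: "gl_act g (const c * p) = const c * gl_act g p"
  and gl_act_sum: "gl_act g (sum f A) = (\<Sum>x\<in>A. gl_act g (f x))"
  unfolding gl_act_eq_lin_ext by (simp_all add: lin_ext_const_times lin_ext_sum coeff_hom_const)

lemma gl_act_1: "gl_act g 1 = 1"
  unfolding gl_act_eq_lin_ext mon_0[symmetric] lin_ext_mon[OF coeff_hom_const] by simp

lemma gl_act_Var: "gl_act g (Var k) = (\<Sum>i\<in>UNIV. const (g $ i $ k) * Var i)"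
  unfolding gl_act_eq_lin_ext Var_def lin_ext_mon[OF coeff_hom_const] prod_power_single ..

lemma gl_act_prod: "gl_act g (prod f A) = (\<Prod>x\<in>A. gl_act g (f x))"
  by (induction A rule: infinite_finite_induct) (simp_all add: gl_act_1 gl_act_mult)

text \<open>The action is an algebra homomorphism and reaches only the forms, not the coefficients
  of \<open>p\<close>. A generic coordinate change thus amounts to a change of the forms.\<close>

lemma gl_act_distraction: "gl_act g (distraction L p) = distraction (\<lambda>i k. gl_act g (L i k)) p"
  unfolding distraction_def by (simp add: gl_act_sum gl_act_const_times gl_act_prod)

lemma Var_homogeneous: "(Var i :: ('n::finite, 'a::comm_ring_1) mpoly) \<in> homogeneous_component 1"
  by (simp add: Var_def homogeneous_component_def)

lemma lookup_Var: "lookup (Var k :: ('n, 'a::comm_ring_1) mpoly) (single l 1) = (if l = k then 1 else 0)"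
proof -
  have "single l (1::nat) = single k 1 \<longleftrightarrow> l = k"
    by (metis lookup_single_eq lookup_single_not_eq zero_neq_one)
  then show ?thesis by (auto simp: Var_def mon_def lookup_single when_def)
qed

lemma lookup_sum_Vars:
  "lookup (\<Sum>k\<in>UNIV. const (f k) * Var k :: ('n::finite, 'a::comm_ring_1) mpoly) (single l 1) = f l"
  by (simp add: lookup_sum lookup_const_times lookup_Var if_distrib[of "(*) _"] cong: if_cong del: One_nat_def)

lemma linear_form_eq:
  fixes p :: "('n::finite, 'a::comm_ring_1) mpoly"
  assumes "p \<in> homogeneous_component 1"
  shows "p = (\<Sum>k\<in>UNIV. const (lookup p (single k 1)) * Var k)" (is "p = ?q")
proof (rule poly_mapping_eqI)
  fix s
  have "?q \<in> homogeneous_component 1"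
    unfolding homogeneous_component_eq
    by (intro mon_space_sum mon_space_const_mult) (simp add: Var_def)
  show "lookup p s = lookup ?q s"
  proof (cases "pp_deg s = 1")
    case True
    then obtain l where "s = single l 1" by (rule single_of_deg_1)
    then show ?thesis by (simp only: lookup_sum_Vars)
  next
    case False
    with assms \<open>?q \<in> homogeneous_component 1\<close> have "s \<notin> keys p" "s \<notin> keys ?q"
      unfolding homogeneous_component_def by auto
    then show ?thesis by (simp add: in_keys_iff)
  qed
qed

lemma homogeneous_gl_act:
  fixes p :: "('n::finite, 'a::comm_ring_1) mpoly"
  assumes "p \<in> homogeneous_component 1"
  shows "gl_act g p \<in> homogeneous_component 1"
proof -
  have "gl_act g (Var k) \<in> homogeneous_component 1" for k
    unfolding gl_act_Var homogeneous_component_eq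
    by (intro mon_space_sum mon_space_const_mult) (simp add: Var_def)
  then show ?thesis
    by (subst linear_form_eq[OF assms])
      (auto simp: gl_act_sum gl_act_const_times homogeneous_component_eq intro!: mon_space_sum mon_space_const_mult)
qed

lemma lookup_gl_act:
  fixes p :: "('n::finite, 'a::comm_ring_1) mpoly"
  assumes "p \<in> homogeneous_component 1"
  shows "lookup (gl_act g p) (single l 1) = (\<Sum>k\<in>UNIV. g $ l $ k * lookup p (single k 1))"
proof -
  have "gl_act g p = (\<Sum>k\<in>UNIV. const (lookup p (single k 1)) * (\<Sum>i\<in>UNIV. const (g $ i $ k) * Var i))"
    by (subst linear_form_eq[OF assms]) (simp only: gl_act_sum gl_act_const_times gl_act_Var)
  then show ?thesis
    by (simp only: lookup_sum[of _ UNIV "single l 1"] lookup_const_times lookup_sum_Vars)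
      (simp add: lookup_sum lookup_const_times lookup_sum_Vars mult.commute)
qed

section \<open>Distraction matrices and their coefficient matrices\<close>

lemma K_span_linear_combination:
  assumes "p \<in> K_span (range f)"
  obtains \<beta> where "p = (\<Sum>i\<in>UNIV. const (\<beta> i) * (f (i :: 'i::finite)))"
proof -
  let ?T = "{p. \<exists>\<beta>. p = (\<Sum>i\<in>UNIV. const (\<beta> i) * f i)}"
  have "K_span (range f) \<subseteq> ?T"
    unfolding K_span_def
  proof (intro module.span_minimal[OF module_const] module.subspaceI[OF module_const])
    show "range f \<subseteq> ?T"
    proof safe
      fix k
      have "const (if i = k then 1 else 0) * f i = (if i = k then f i else 0)" for i by simp
      then have "f k = (\<Sum>i\<in>UNIV. const (if i = k then 1 else 0) * f i)" by simp
      then show "\<exists>\<beta>. f k = (\<Sum>i\<in>UNIV. const (\<beta> i) * f i)"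
        by (rule exI[of _ "\<lambda>i. if i = k then 1 else 0"])
    qed
    show "0 \<in> ?T" by (intro CollectI exI[of _ "\<lambda>_. 0"]) simp
    show "x + y \<in> ?T" if "x \<in> ?T" "y \<in> ?T" for x y
    proof -
      from that obtain \<beta> \<gamma> where "x = (\<Sum>i\<in>UNIV. const (\<beta> i) * f i)" "y = (\<Sum>i\<in>UNIV. const (\<gamma> i) * f i)" by blast
      then have "x + y = (\<Sum>i\<in>UNIV. const (\<beta> i + \<gamma> i) * f i)"
        by (simp add: const_add distrib_right sum.distrib)
      then show ?thesis by (intro CollectI exI[of _ "\<lambda>i. \<beta> i + \<gamma> i"])
    qed
    show "const c * x \<in> ?T" if "x \<in> ?T" for c x
    proof -
      from that obtain \<beta> where "x = (\<Sum>i\<in>UNIV. const (\<beta> i) * f i)" by blast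
      then have "const c * x = (\<Sum>i\<in>UNIV. const (c * \<beta> i) * f i)"
        by (simp add: const_mult sum_distrib_left mult.assoc)
      then show ?thesis by (intro CollectI exI[of _ "\<lambda>i. c * \<beta> i"])
    qed
  qed
  with assms have "p \<in> ?T" by blast
  then show ?thesis using that by blast
qed

lemma distraction_matrixD:
  assumes "distraction_matrix L"
  shows distraction_matrix_linear: "k \<ge> 1 \<Longrightarrow> L i k \<in> homogeneous_component 1"
    and distraction_matrix_span: "(\<And>i. c i \<ge> 1) \<Longrightarrow> K_span (range (\<lambda>i. L i (c i))) = homogeneous_component 1"
    and distraction_matrix_stable: "\<exists>N\<ge>1. \<forall>i. \<forall>j>N. L i j = L i N"
  using assms unfolding distraction_matrix_def by blast+

text \<open>Since the forms span all linear forms, their coefficient matrix has a right inverse,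
  which for square matrices is a left inverse. As a coordinate change, \<open>B\<close> sends each
  \<open>L i (c i)\<close> to x_i and so serves as a witness of genericity.\<close>

lemma distraction_matrix_inverse:
  fixes L :: "'n::finite \<Rightarrow> nat \<Rightarrow> ('n, 'a::field) mpoly"
  assumes L: "distraction_matrix L" and c: "\<And>i. c i \<ge> 1"
  obtains B :: "'a^'n^'n" where
    "\<And>l i. (\<Sum>m\<in>UNIV. B $ l $ m * lookup (L i (c i)) (single m 1)) = (if l = i then 1 else 0)"
proof -
  have "\<forall>k. \<exists>\<beta>. Var k = (\<Sum>i\<in>UNIV. const (\<beta> i) * L i (c i))"
  proof
    fix k
    have "Var k \<in> K_span (range (\<lambda>i. L i (c i)))"
      unfolding distraction_matrix_span[of L c, OF L c] by (rule Var_homogeneous)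
    then show "\<exists>\<beta>. Var k = (\<Sum>i\<in>UNIV. const (\<beta> i) * L i (c i))"
      by (rule K_span_linear_combination) blast
  qed
  from choice[OF this] obtain \<beta> where \<beta>: "\<And>k. Var k = (\<Sum>i\<in>UNIV. const (\<beta> k i) * L i (c i))" by blast
  define \<Lambda> :: "'a^'n^'n" where "\<Lambda> = (\<chi> m i. lookup (L i (c i)) (single m 1))"
  define B :: "'a^'n^'n" where "B = (\<chi> i k. \<beta> k i)"
  have "(\<Sum>i\<in>UNIV. \<Lambda> $ m $ i * B $ i $ k) = (if m = k then 1 else 0)" for m k
  proof -
    have "(if m = k then 1 else 0) = lookup (Var k :: ('n, 'a) mpoly) (single m 1)"
      by (simp only: lookup_Var)
    also have "\<dots> = (\<Sum>i\<in>UNIV. \<beta> k i * lookup (L i (c i)) (single m 1))"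
      by (subst \<beta>) (simp only: lookup_sum lookup_const_times)
    finally show ?thesis by (simp add: \<Lambda>_def B_def mult.commute)
  qed
  then have "\<Lambda> ** B = mat 1"
    by (simp add: matrix_matrix_mult_def mat_def vec_eq_iff)
  then have "B ** \<Lambda> = mat 1"
    by (simp add: matrix_left_right_inverse)
  then have "(B ** \<Lambda>) $ l $ i = (if l = i then 1 else 0)" for l i
    by (simp add: mat_def)
  then show ?thesis
    using that[of B] by (simp add: matrix_matrix_mult_def \<Lambda>_def)
qed

lemma generic_forms_gl_act:
  fixes L :: "'n::{finite,linorder} \<Rightarrow> nat \<Rightarrow> ('n, 'a::field) mpoly"
  assumes inf: "infinite (UNIV :: 'a set)" and L: "distraction_matrix L"
  obtains F g0 where "poly_fun F" "F g0 \<noteq> 0"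
    "\<And>g. F g \<noteq> 0 \<Longrightarrow> generic_forms (\<lambda>i k. gl_act g (L i k))"
proof -
  obtain N where N: "N \<ge> 1" "\<And>i j. j > N \<Longrightarrow> L i j = L i N"
    using distraction_matrix_stable[OF L] by blast
  \<comment> \<open>Columns beyond \<open>N\<close> repeat column \<open>N\<close>, so these
    finitely many choices represent all choices of columns.\<close>
  define C where "C = (\<Pi>\<^sub>E i\<in>(UNIV :: 'n set). {1..N})"
  have "finite C" unfolding C_def by (intro finite_PiE) simp_all
  define lc where "lc i k m = lookup (L i k) (single m 1)" for i k m
  define E where "E = (\<lambda>(i, k) (g :: (('a, 'n) vec, 'n) vec). \<Sum>m\<in>UNIV. g $ Min UNIV $ m * lc i k m)"
  \<comment> \<open>Padding the upper left block with the identity makes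
    \<open>det (A c j g)\<close> the leading minor up to \<open>j\<close> of the coefficient matrix
    of the transformed forms.\<close>
  define A where "A c j g = (\<chi> l i. if l \<le> j \<and> i \<le> j then \<Sum>m\<in>UNIV. g $ l $ m * lc i (c i) m else if l = i then 1 else 0)"
    for c :: "'n \<Rightarrow> nat" and j and g :: "(('a, 'n) vec, 'n) vec"
  define F1 where "F1 g = (\<Prod>x\<in>UNIV \<times> {1..N}. E x g)" for g
  define F2 where "F2 g = (\<Prod>x\<in>C \<times> UNIV. det (A (fst x) (snd x) g))" for g
  have E: "poly_fun (E x)" for x
    unfolding E_def by (cases x) (auto intro!: poly_fun_sum poly_fun_mult poly_fun_entry poly_fun_const)
  have A: "poly_fun (\<lambda>g. det (A c j g))" for c j
  proof (rule poly_fun_det)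
    fix l i show "poly_fun (\<lambda>g. A c j g $ l $ i)"
      by (cases "l \<le> j \<and> i \<le> j")
        (auto simp: A_def intro!: poly_fun_sum poly_fun_mult poly_fun_entry poly_fun_const)
  qed
  have "\<exists>g. E x g \<noteq> 0" if x: "x \<in> UNIV \<times> {1..N}" for x
  proof -
    obtain i k where ik: "x = (i, k)" "k \<ge> 1" using x by auto
    obtain B :: "(('a, 'n) vec, 'n) vec" where "\<And>l i'. (\<Sum>m\<in>UNIV. B $ l $ m * lookup (L i' k) (single m 1)) = (if l = i' then 1 else 0)"
      using distraction_matrix_inverse[OF L, of "\<lambda>_. k"] ik(2) by blast
    then have "(\<Sum>m\<in>UNIV. B $ i $ m * lc i k m) \<noteq> 0" by (simp add: lc_def)
    then have "\<exists>m. lc i k m \<noteq> 0" by (rule contrapos_np) simp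
    then obtain m where "lc i k m \<noteq> 0" by blast
    \<comment> \<open>This matrix sends x_m to the sum of all variables and the others to 0. It may
      be singular, since invertibility is imposed separately in \<open>gin_eqI\<close>.\<close>
    moreover have "E x (\<chi> l m'. if m' = m then 1 else 0) = lc i k m"
      by (simp add: E_def ik(1) if_distrib[of "\<lambda>y. y * _"] cong: if_cong)
    ultimately have "E x (\<chi> l m'. if m' = m then 1 else 0) \<noteq> 0" by simp
    then show ?thesis by (rule exI)
  qed
  then obtain g1 where "F1 g1 \<noteq> 0"
    unfolding F1_def using poly_fun_prod_nonzero[OF inf, of "UNIV \<times> {1..N}" E] E by auto
  have "\<exists>g. det (A (fst x) (snd x) g) \<noteq> 0" if x: "x \<in> C \<times> UNIV" for x
  proof -
    obtain c j where cj: "x = (c, j)" "c \<in> C" using x by auto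
    have "c i \<ge> 1" for i using cj(2) by (auto simp: C_def PiE_iff)
    then obtain B :: "(('a, 'n) vec, 'n) vec" where "\<And>l i. (\<Sum>m\<in>UNIV. B $ l $ m * lookup (L i (c i)) (single m 1)) = (if l = i then 1 else 0)"
      using distraction_matrix_inverse[OF L] by blast
    \<comment> \<open>\<open>B\<close> turns the chosen forms into the variables, so the block is an
      identity matrix too.\<close>
    then have "A c j B = mat 1"
      by (simp add: A_def mat_def vec_eq_iff lc_def)
    then show ?thesis by (intro exI[of _ B]) (simp add: cj)
  qed
  then obtain g2 where "F2 g2 \<noteq> 0"
    unfolding F2_def using poly_fun_prod_nonzero[OF inf, of "C \<times> UNIV" "\<lambda>x g. det (A (fst x) (snd x) g)"] A \<open>finite C\<close> by auto
  have F12: "poly_fun F1" "poly_fun F2"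
    unfolding F1_def F2_def by (intro poly_fun_prod E A)+
  obtain g0 where "F1 g0 \<noteq> 0" "F2 g0 \<noteq> 0"
    using poly_fun_mult_nonzero[OF inf F12(1) \<open>F1 g1 \<noteq> 0\<close> F12(2) \<open>F2 g2 \<noteq> 0\<close>] by blast
  then have g0: "F1 g0 * F2 g0 \<noteq> 0" by simp
  have "generic_forms (\<lambda>i k. gl_act g (L i k))" if g: "F1 g * F2 g \<noteq> 0" for g
    unfolding generic_forms_def
  proof (intro conjI allI impI)
    show "gl_act g (L i k) \<in> homogeneous_component 1" if "1 \<le> k" for i k
      by (intro homogeneous_gl_act distraction_matrix_linear[OF L that])
    have trunc: "L i k = L i (min k N)" for i k
      using N(2)[of k i] by (cases "k > N") auto
    show "lookup (gl_act g (L i k)) (single (Min UNIV) 1) \<noteq> 0" if "1 \<le> k" for i k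
    proof -
      have "(i, min k N) \<in> UNIV \<times> {1..N}" using that N(1) by auto
      moreover have "\<forall>x\<in>UNIV \<times> {1..N}. E x g \<noteq> 0"
        using g by (auto simp: F1_def)
      ultimately have "E (i, min k N) g \<noteq> 0" by blast
      then show ?thesis
        unfolding lookup_gl_act[OF distraction_matrix_linear[OF L that]]
        by (simp add: E_def lc_def flip: trunc)
    qed
    fix c :: "'n \<Rightarrow> nat" and j i :: 'n assume c: "\<forall>k. 1 \<le> c k" and "i \<le> j"
    define c' where "c' k = min (c k) N" for k
    have Lc: "L k (c k) = L k (c' k)" for k unfolding c'_def by (rule trunc)
    have hom: "L k (c' k) \<in> homogeneous_component 1" for k
      using distraction_matrix_linear[OF L, of "c k" k] c Lc by simp
    have "c' \<in> C" using c N(1) by (auto simp: C_def c'_def)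
    moreover have "\<forall>x\<in>C \<times> UNIV. det (A (fst x) (snd x) g) \<noteq> 0"
      using g \<open>finite C\<close> by (auto simp: F2_def)
    ultimately have "det (A c' j g) \<noteq> 0" by force
    then obtain B where B: "A c' j g ** B = mat 1"
      unfolding invertible_det_nz[symmetric] invertible_def by blast
    \<comment> \<open>A column of the inverse: the resulting combination has the same coefficients
      at x_1, ..., x_j as x_i, so that only later variables survive in the difference.\<close>
    define \<beta> where "\<beta> k = B $ k $ i" for k
    let ?p = "(\<Sum>k\<le>j. const (\<beta> k) * gl_act g (L k (c k))) - Var i"
    have "keys ?p \<subseteq> {single r 1 | r. j < r}"
    proof
      fix s assume s: "s \<in> keys ?p"
      have "(\<Sum>k\<le>j. const (\<beta> k) * gl_act g (L k (c k))) \<in> homogeneous_component 1"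
        unfolding homogeneous_component_eq Lc
        by (intro mon_space_sum mon_space_const_mult) (use homogeneous_gl_act[OF hom] in \<open>simp add: homogeneous_component_eq\<close>)
      then have "pp_deg s = 1"
        using s keys_diff[of "\<Sum>k\<le>j. const (\<beta> k) * gl_act g (L k (c k))" "Var i"] Var_homogeneous[of i]
        unfolding homogeneous_component_def by auto
      then obtain l where l: "s = single l 1" by (rule single_of_deg_1)
      have "lookup ?p (single l 1) = 0" if "l \<le> j"
      proof -
        have "(if l = i then 1 else 0) = (A c' j g ** B) $ l $ i"
          unfolding B by (simp add: mat_def)
        also have "\<dots> = (\<Sum>k\<in>UNIV. A c' j g $ l $ k * \<beta> k)"
          by (simp add: matrix_matrix_mult_def \<beta>_def)
        also have "\<dots> = (\<Sum>k\<le>j. (\<Sum>m\<in>UNIV. g $ l $ m * lc k (c' k) m) * \<beta> k)"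
          using that by (intro sum.mono_neutral_cong_right) (auto simp: A_def)
        also have "\<dots> = lookup (\<Sum>k\<le>j. const (\<beta> k) * gl_act g (L k (c k))) (single l 1)"
          unfolding lookup_sum lookup_const_times Lc lookup_gl_act[OF hom]
          by (simp add: lc_def mult.commute)
        finally show ?thesis
          unfolding lookup_minus lookup_Var by simp
      qed
      with s l have "j < l" by (auto simp: in_keys_iff not_le[symmetric])
      with l show "s \<in> {single r 1 | r. j < r}" by blast
    qed
    then show "\<exists>\<beta>. keys ((\<Sum>k\<le>j. const (\<beta> k) * gl_act g (L k (c k))) - Var i) \<subseteq> {single r 1 | r. j < r}"
      by blast
  qed
  with that[of "\<lambda>g. F1 g * F2 g" g0] g0 F12 show ?thesis
    by (simp add: poly_fun_mult)
qed

theorem gin_distraction: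
  fixes L :: "'n::{finite,linorder} \<Rightarrow> nat \<Rightarrow> ('n, 'a::field) mpoly"
  assumes inf: "infinite (UNIV :: 'a set)" and \<tau>: "term_ordering \<tau>" and L: "distraction_matrix L"
    and cases: "\<tau> = drl \<or> (\<forall>i. \<forall>k\<ge>1. L i k = L i 1)"
  shows "gin \<tau> (distraction L ` mon_space (stable_pps t)) = mon_space (gin_pps t)"
proof -
  obtain F g0 where F: "poly_fun F" "F g0 \<noteq> 0" "\<And>g. F g \<noteq> 0 \<Longrightarrow> generic_forms (\<lambda>i k. gl_act g (L i k))"
    using generic_forms_gl_act[OF inf L] by blast
  show ?thesis
  proof (rule gin_eqI[OF inf _ F(1,2)])
    show "monomial_ideal (mon_space (gin_pps t) :: ('n, 'a) mpoly set)"
      by (rule monomial_ideal_mon_space[OF up_closed_gin_pps])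
    fix g assume "F g \<noteq> 0"
    then have h: "generic_forms (\<lambda>i k. gl_act g (L i k))" by (rule F(3))
    have "\<tau> = drl \<or> (\<forall>i. \<forall>k\<ge>1. gl_act g (L i k) = gl_act g (L i 1))"
      using cases by metis
    then have "initial_ideal \<tau> (distraction (\<lambda>i k. gl_act g (L i k)) ` mon_space (stable_pps t)) = mon_space (gin_pps t)"
      by (rule initial_ideal_distraction[OF \<tau> h])
    then show "initial_ideal \<tau> (gl_act g ` distraction L ` mon_space (stable_pps t)) = mon_space (gin_pps t)"
      by (simp add: image_image gl_act_distraction)
  qed
qed

section \<open>The trivial distraction and the conclusion\<close>

lemma distraction_Var:
  fixes p :: "('n::finite, 'a::comm_ring_1) mpoly"
  shows "distraction (\<lambda>i k. Var i) p = p"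
proof -
  have "dist_mon (\<lambda>i k. Var i) s = (mon s :: ('n, 'a) mpoly)" for s
  proof (induction "pp_deg s" arbitrary: s)
    case 0
    then show ?case by (simp add: pp_deg_eq_0_iff)
  next
    case (Suc d)
    then have "s \<noteq> 0" by auto
    then obtain i where i: "lookup s i \<noteq> 0"
      by (metis lookup_zero poly_mapping_eqI)
    define s' where "s' = s - single i 1"
    have s: "s = s' + single i 1"
      unfolding s'_def using i by (intro pp_diff_add[symmetric]) (auto simp: lookup_single when_def)
    then have "d = pp_deg s'" using Suc.hyps(2) by (simp add: pp_deg_add)
    then have "dist_mon (\<lambda>i k. Var i) s' = (mon s' :: ('n, 'a) mpoly)" by (rule Suc.hyps(1))
    then show ?case
      unfolding s dist_mon_add_single mon_add Var_def by (simp add: mult.commute)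
  qed
  then show ?thesis
    unfolding distraction_eq_lin_ext lin_ext_def by (simp add: sum_mon_keys)
qed

lemma distraction_matrix_Var:
  "distraction_matrix (\<lambda>i k. Var i :: ('n::finite, 'a::comm_ring_1) mpoly)"
proof -
  have "K_span (range Var) = (homogeneous_component 1 :: ('n, 'a) mpoly set)"
  proof
    show "K_span (range Var) \<subseteq> (homogeneous_component 1 :: ('n, 'a) mpoly set)"
      unfolding K_span_def homogeneous_component_eq
      by (intro module.span_minimal[OF module_const] module.subspaceI[OF module_const])
        (auto intro: mon_space_0 mon_space_add mon_space_const_mult simp: Var_def)
    show "homogeneous_component 1 \<subseteq> (K_span (range Var) :: ('n, 'a) mpoly set)"
    proof
      fix p :: "('n, 'a) mpoly" assume "p \<in> homogeneous_component 1"
      then have "p = (\<Sum>k\<in>UNIV. const (lookup p (single k 1)) * Var k)" by (rule linear_form_eq)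
      also have "\<dots> \<in> K_span (range Var)"
        unfolding K_span_def
        by (intro module.span_sum[OF module_const] module.span_scale[OF module_const] module.span_base[OF module_const]) simp
      finally show "p \<in> K_span (range Var)" .
    qed
  qed
  then show ?thesis
    unfolding distraction_matrix_def using Var_homogeneous by auto
qed

theorem theorem4p5:
  fixes t :: "'n::{finite,linorder} pp"
    and a b c :: "'n \<Rightarrow> nat"
    and I :: "('n, 'a::field) mpoly set"
  assumes "infinite (UNIV :: 'a set)"
    and "\<And>k. a k = Poly_Mapping.lookup t k"
    and "I = Stable t"
    and "\<And>j. b j = (\<Sum>k | k < j. a k)"
    and "\<And>j. c j = (\<Sum>k | k \<ge> j. a k)"
  shows "(\<forall>\<tau> :: 'n pp rel. term_ordering \<tau> \<longrightarrow>
            gin \<tau> I =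
              (\<Sum>j\<in>UNIV. ideal_mult (ideal {Var (Min UNIV) ^ b j})
                              (ideal_power (ideal (Var ` {..j})) (c j)))) \<and>
         (\<forall>L :: 'n \<Rightarrow> nat \<Rightarrow> ('n, 'a) mpoly. distraction_matrix L \<longrightarrow>
            gin drl (distraction L ` I) = gin drl I)"
proof -
  have I: "I = mon_space (stable_pps t)"
    by (simp add: assms(3) Stable_eq)
  have "b j = (\<Sum>k<j. lookup t k)" "c j = (\<Sum>k | j \<le> k. lookup t k)" for j
    by (simp_all add: assms(2,4,5) lessThan_def)
  then have rhs: "(\<Sum>j\<in>UNIV. ideal_mult (ideal {Var (Min UNIV) ^ b j})
      (ideal_power (ideal (Var ` {..j})) (c j))) = (mon_space (gin_pps t) :: ('n, 'a) mpoly set)"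
    by (simp only: gin_pps_ideal)
  have gin_I: "gin \<tau> I = mon_space (gin_pps t)" if "term_ordering \<tau>" for \<tau>
    using gin_distraction[OF assms(1) that distraction_matrix_Var, of t]
    by (simp add: I distraction_Var)
  show ?thesis
    unfolding rhs
    using gin_I term_ordering_drl gin_distraction[OF assms(1) term_ordering_drl, of _ t]
    by (auto simp: I)
qed

end
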